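(* Let $\widetilde M(\phi,\xi,\eta,g)$ be a paracosymplectic manifold and let $M=F\times_f B$ be a $\mathcal{P}\mathcal{R}$-semi-invariant warped product submanifold of $\widetilde M$ such that the characteristic vector field $\xi$ is tangent to $F$. Then the invariant distribution $\mathfrak{D}$ and the anti-invariant distribution $\mathfrak{D}^{\bot}$ of $M$ are always integrable.
   Context: Almost paracontact manifold: a smooth $(2m+1)$-manifold $\widetilde M$ with a $(1,1)$-tensor field $\phi$, a vector field $\xi$ (the characteristic vector field) and a $1$-form $\eta$ such that $\phi^2=\mathrm{Id}-\eta\otimes\xi$, $\eta(\xi)=1$, and on the distribution $\ker\eta$ the eigendistributions of $\phi$ for the eigenvalues $+1$ and $-1$ both have dimension $m$. Almost paracontact metric manifold: in addition a pseudo-Riemannian metric $g$ (necessarily of signature $(m+1,m)$) with $g(X,Y)=-g(\phi X,\phi Y)+\eta(X)\eta(Y)$; then $\eta(X)=g(X,\xi)$. Put $\Phi(X,Y)=g(X,\phi Y)$. It is paracosymplectic if $\widetilde\nabla\eta=0$ and $\widetilde\nabla\Phi=0$, where $\widetilde\nabla$ is the Levi-Civita connection of $g$. Submanifolds carry the induced metric, also denoted $g$. A submanifold is invariant if $\phi$ maps each of its tangent vectors to a tangent vector of it, and anti-invariant if $\phi$ maps each of its tangent vectors to a normal vector. Warped product: for pseudo-Riemannian manifolds $(N_1,g_1)$, $(N_2,g_2)$ and a positive smooth function $f$ on $N_1$, $N_1\times_f N_2$ is the product manifold $N_1\times N_2$ with the metric $g=g_1+f^2g_2$ (with $f$ pulled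 back to the product); $f$ is the warping function. A $\mathcal{P}\mathcal{R}$-semi-invariant submanifold of an almost paracontact metric manifold $\widetilde M$ is an isometrically immersed pseudo-Riemannian submanifold $M$ furnished with a pair of orthogonal distributions $(\mathfrak{D},\mathfrak{D}^{\bot})$ such that (i) $TM=\mathfrak{D}\oplus\mathfrak{D}^{\bot}\oplus\langle\xi\rangle$; (ii) $\mathfrak{D}$ is invariant: $\phi(\mathfrak{D})=\mathfrak{D}$; (iii) $\mathfrak{D}^{\bot}$ is anti-invariant: $\phi(\mathfrak{D}^{\bot})\subset TM^{\bot}$. It is a $\mathcal{P}\mathcal{R}$-semi-invariant warped product if it is a warped product of the form $B\times_f F$ or $F\times_f B$, where $B$ is an invariant submanifold and $F$ an anti-invariant submanifold of $\widetilde M$, and $f$ is a non-constant positive smooth function on the first factor. *)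

theory Defs
  imports "HOL-Analysis.Analysis"
begin

section \<open>Smooth maps between Euclidean spaces\<close>

text \<open>The following are meant for open \<open>S\<close>.\<close>

primrec Ck_on ::
  "nat \<Rightarrow> 'e::euclidean_space set \<Rightarrow> ('e \<Rightarrow> 'c::real_normed_vector) \<Rightarrow> bool" where
  "Ck_on 0 S f \<longleftrightarrow> continuous_on S f"
| "Ck_on (Suc k) S f \<longleftrightarrow> (\<forall>x\<in>S. f differentiable (at x)) \<and>
     (\<forall>v. Ck_on k S (\<lambda>x. frechet_derivative f (at x) v))"

definition smooth_on :: "'e::euclidean_space set \<Rightarrow> ('e \<Rightarrow> 'c::real_normed_vector) \<Rightarrow> bool" where
  "smooth_on S f \<longleftrightarrow> (\<forall>k. Ck_on k S f)"

section \<open>Smooth manifolds\<close>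

text \<open>
  A manifold is a whole type, Hausdorff and second countable by its type class, with an atlas
  \<open>ch\<close> modelled on a Euclidean space \<open>'e\<close>. The atlas is indexed by points: \<open>ch p\<close> is a
  distinguished chart around \<open>p\<close>, and the maximal atlas is generated by the range of \<open>ch\<close>.
  The tangent space at \<open>p\<close> is \<open>'e\<close>, a tangent vector being identified with its components in the
  distinguished chart at \<open>p\<close>. So a vector field is a function \<open>'a \<Rightarrow> 'e\<close> whose value at each
  point is read in the chart distinguished at that point.
\<close>

type_synonym ('a, 'e) chart = "'a set \<times> ('a \<Rightarrow> 'e)"
type_synonym ('a, 'e) atlas = "'a \<Rightarrow> ('a, 'e) chart"

definition is_chart :: "('a::topological_space, 'e::euclidean_space) chart \<Rightarrow> bool" where
  "is_chart c \<longleftrightarrow> (case c of (U, \<psi>) \<Rightarrow>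
     open U \<and> open (\<psi> ` U) \<and> homeomorphism U (\<psi> ` U) \<psi> (inv_into U \<psi>))"

definition cdom :: "('a, 'e) atlas \<Rightarrow> 'a \<Rightarrow> 'a set" where
  "cdom ch p = fst (ch p)"

definition cmap :: "('a, 'e) atlas \<Rightarrow> 'a \<Rightarrow> 'a \<Rightarrow> 'e" where
  "cmap ch p = snd (ch p)"

definition cinv :: "('a, 'e) atlas \<Rightarrow> 'a \<Rightarrow> 'e \<Rightarrow> 'a" where
  "cinv ch p = inv_into (cdom ch p) (cmap ch p)"

definition smooth_manifold ::
  "('a::{t2_space,second_countable_topology}, 'e::euclidean_space) atlas \<Rightarrow> bool" where
  "smooth_manifold ch \<longleftrightarrow>
     (\<forall>p. is_chart (ch p) \<and> p \<in> cdom ch p) \<and>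
     (\<forall>p q. smooth_on (cmap ch p ` (cdom ch p \<inter> cdom ch q)) (cmap ch q \<circ> cinv ch p))"

text \<open>Membership of a chart in the maximal atlas.\<close>

definition compatible_chart ::
  "('a::{t2_space,second_countable_topology}, 'e::euclidean_space) atlas \<Rightarrow> ('a, 'e) chart \<Rightarrow> bool"
  where
  "compatible_chart ch c \<longleftrightarrow> is_chart c \<and> (case c of (U, \<psi>) \<Rightarrow>
     \<forall>p. smooth_on (cmap ch p ` (cdom ch p \<inter> U)) (\<psi> \<circ> cinv ch p) \<and>
         smooth_on (\<psi> ` (cdom ch p \<inter> U)) (cmap ch p \<circ> inv_into U \<psi>))"

definition smooth_fun_on ::
  "('a::{t2_space,second_countable_topology}, 'e::euclidean_space) atlas \<Rightarrow> 'a set \<Rightarrow>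
   ('a \<Rightarrow> 'c::real_normed_vector) \<Rightarrow> bool" where
  "smooth_fun_on ch W h \<longleftrightarrow> (\<forall>p. smooth_on (cmap ch p ` (cdom ch p \<inter> W)) (h \<circ> cinv ch p))"

text \<open>The derivative \<open>v(h)\<close> of a (possibly vector-valued) function along a tangent vector at \<open>p\<close>.\<close>

definition dfun ::
  "('a::{t2_space,second_countable_topology}, 'e::euclidean_space) atlas \<Rightarrow>
   ('a \<Rightarrow> 'c::real_normed_vector) \<Rightarrow> 'a \<Rightarrow> 'e \<Rightarrow> 'c" where
  "dfun ch h p v = frechet_derivative (h \<circ> cinv ch p) (at (cmap ch p p)) v"

text \<open>
  The components of the vector field \<open>X\<close> in the chart \<open>ch p\<close>, as a function of the coordinates
  \<open>x\<close>: the value of \<open>X\<close> at \<open>q\<close> is transported from the chart \<open>ch q\<close> to \<open>ch p\<close>.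
\<close>

definition vf_rep ::
  "('a::{t2_space,second_countable_topology}, 'e::euclidean_space) atlas \<Rightarrow> 'a \<Rightarrow>
   ('a \<Rightarrow> 'e) \<Rightarrow> 'e \<Rightarrow> 'e" where
  "vf_rep ch p X x = (let q = cinv ch p x in dfun ch (cmap ch p) q (X q))"

definition smooth_vf_on ::
  "('a::{t2_space,second_countable_topology}, 'e::euclidean_space) atlas \<Rightarrow> 'a set \<Rightarrow>
   ('a \<Rightarrow> 'e) \<Rightarrow> bool" where
  "smooth_vf_on ch W X \<longleftrightarrow> (\<forall>p. smooth_on (cmap ch p ` (cdom ch p \<inter> W)) (vf_rep ch p X))"

definition lie_bracket ::
  "('a::{t2_space,second_countable_topology}, 'e::euclidean_space) atlas \<Rightarrow>
   ('a \<Rightarrow> 'e) \<Rightarrow> ('a \<Rightarrow> 'e) \<Rightarrow> 'a \<Rightarrow> 'e" where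
  "lie_bracket ch X Y p =
     frechet_derivative (vf_rep ch p Y) (at (cmap ch p p)) (X p) -
     frechet_derivative (vf_rep ch p X) (at (cmap ch p p)) (Y p)"

subsection \<open>Smooth maps, immersions, products\<close>

definition smooth_map ::
  "('a::{t2_space,second_countable_topology}, 'e::euclidean_space) atlas \<Rightarrow>
   ('b::{t2_space,second_countable_topology}, 'f::euclidean_space) atlas \<Rightarrow> ('a \<Rightarrow> 'b) \<Rightarrow> bool" where
  "smooth_map ch ch' F \<longleftrightarrow> continuous_on UNIV F \<and>
     (\<forall>p q. smooth_on (cmap ch p ` (cdom ch p \<inter> F -` cdom ch' q)) (cmap ch' q \<circ> F \<circ> cinv ch p))"

definition differential ::
  "('a::{t2_space,second_countable_topology}, 'e::euclidean_space) atlas \<Rightarrow>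
   ('b::{t2_space,second_countable_topology}, 'f::euclidean_space) atlas \<Rightarrow> ('a \<Rightarrow> 'b) \<Rightarrow>
   'a \<Rightarrow> 'e \<Rightarrow> 'f" where
  "differential ch ch' F p = dfun ch (cmap ch' (F p) \<circ> F) p"

definition immersion ::
  "('a::{t2_space,second_countable_topology}, 'e::euclidean_space) atlas \<Rightarrow>
   ('b::{t2_space,second_countable_topology}, 'f::euclidean_space) atlas \<Rightarrow> ('a \<Rightarrow> 'b) \<Rightarrow> bool" where
  "immersion ch ch' F \<longleftrightarrow> smooth_map ch ch' F \<and> (\<forall>p. inj (differential ch ch' F p))"

text \<open>
  With this product atlas the tangent space of the product at \<open>(x, y)\<close> is literally the product of
  the tangent spaces at \<open>x\<close> and \<open>y\<close>.
\<close>

definition prod_atlas ::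
  "('a, 'e) atlas \<Rightarrow> ('b, 'f) atlas \<Rightarrow> ('a \<times> 'b, 'e \<times> 'f) atlas" where
  "prod_atlas ch ch' = (\<lambda>(x, y). (cdom ch x \<times> cdom ch' y, map_prod (cmap ch x) (cmap ch' y)))"

section \<open>Pseudo-Riemannian metrics and the Levi-Civita connection\<close>

text \<open>
  Smoothness of a tensor field: it sends smooth vector fields on open sets to smooth functions
  (or smooth vector fields).
\<close>

definition pseudo_riemannian ::
  "('a::{t2_space,second_countable_topology}, 'e::euclidean_space) atlas \<Rightarrow>
   ('a \<Rightarrow> 'e \<Rightarrow> 'e \<Rightarrow> real) \<Rightarrow> bool" where
  "pseudo_riemannian ch g \<longleftrightarrow> smooth_manifold ch \<and>
     (\<forall>p. bilinear (g p)) \<and>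
     (\<forall>p u v. g p u v = g p v u) \<and>
     (\<forall>p u. (\<forall>v. g p u v = 0) \<longrightarrow> u = 0) \<and>
     (\<forall>W X Y. open W \<and> smooth_vf_on ch W X \<and> smooth_vf_on ch W Y \<longrightarrow>
        smooth_fun_on ch W (\<lambda>q. g q (X q) (Y q)))"

text \<open>
  An affine connection is given by \<open>nab p v Y\<close>, the covariant derivative at \<open>p\<close> along the tangent
  vector \<open>v\<close> of a vector field \<open>Y\<close> that is smooth on some open neighbourhood of \<open>p\<close>. That it only
  depends on the germ of \<open>Y\<close> follows from the product rule, applied to a function \<open>h\<close> that is \<open>1\<close>
  near \<open>p\<close> and \<open>0\<close> elsewhere. Nothing is required where \<open>Y\<close> is not smooth.
\<close>

definition affine_connection ::
  "('a::{t2_space,second_countable_topology}, 'e::euclidean_space) atlas \<Rightarrow>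
   ('a \<Rightarrow> 'e \<Rightarrow> ('a \<Rightarrow> 'e) \<Rightarrow> 'e) \<Rightarrow> bool" where
  "affine_connection ch nab \<longleftrightarrow>
     (\<forall>W Y. open W \<and> smooth_vf_on ch W Y \<longrightarrow> (\<forall>p\<in>W. linear (\<lambda>v. nab p v Y))) \<and>
     (\<forall>W Y Z. open W \<and> smooth_vf_on ch W Y \<and> smooth_vf_on ch W Z \<longrightarrow>
        (\<forall>p\<in>W. \<forall>v. nab p v (\<lambda>q. Y q + Z q) = nab p v Y + nab p v Z)) \<and>
     (\<forall>W Y (h::'a \<Rightarrow> real). open W \<and> smooth_vf_on ch W Y \<and> smooth_fun_on ch W h \<longrightarrow>
        (\<forall>p\<in>W. \<forall>v. nab p v (\<lambda>q. h q *\<^sub>R Y q) = dfun ch h p v *\<^sub>R Y p + h p *\<^sub>R nab p v Y)) \<and>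
     (\<forall>W X Y. open W \<and> smooth_vf_on ch W X \<and> smooth_vf_on ch W Y \<longrightarrow>
        smooth_vf_on ch W (\<lambda>q. nab q (X q) Y))"

definition levi_civita ::
  "('a::{t2_space,second_countable_topology}, 'e::euclidean_space) atlas \<Rightarrow>
   ('a \<Rightarrow> 'e \<Rightarrow> 'e \<Rightarrow> real) \<Rightarrow> ('a \<Rightarrow> 'e \<Rightarrow> ('a \<Rightarrow> 'e) \<Rightarrow> 'e) \<Rightarrow> bool" where
  "levi_civita ch g nab \<longleftrightarrow> affine_connection ch nab \<and>
     (\<forall>W X Y. open W \<and> smooth_vf_on ch W X \<and> smooth_vf_on ch W Y \<longrightarrow>
        (\<forall>p\<in>W. nab p (X p) Y - nab p (Y p) X = lie_bracket ch X Y p)) \<and>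
     (\<forall>W Y Z. open W \<and> smooth_vf_on ch W Y \<and> smooth_vf_on ch W Z \<longrightarrow>
        (\<forall>p\<in>W. \<forall>v. dfun ch (\<lambda>q. g q (Y q) (Z q)) p v
                    = g p (nab p v Y) (Z p) + g p (Y p) (nab p v Z)))"

text \<open>Vanishing of the covariant derivative of a 1-form and of a \<open>(0,2)\<close>-tensor field.\<close>

definition parallel_form ::
  "('a::{t2_space,second_countable_topology}, 'e::euclidean_space) atlas \<Rightarrow>
   ('a \<Rightarrow> 'e \<Rightarrow> ('a \<Rightarrow> 'e) \<Rightarrow> 'e) \<Rightarrow> ('a \<Rightarrow> 'e \<Rightarrow> real) \<Rightarrow> bool" where
  "parallel_form ch nab \<omega> \<longleftrightarrow>
     (\<forall>W Y. open W \<and> smooth_vf_on ch W Y \<longrightarrow>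
        (\<forall>p\<in>W. \<forall>v. dfun ch (\<lambda>q. \<omega> q (Y q)) p v - \<omega> p (nab p v Y) = 0))"

definition parallel_tensor2 ::
  "('a::{t2_space,second_countable_topology}, 'e::euclidean_space) atlas \<Rightarrow>
   ('a \<Rightarrow> 'e \<Rightarrow> ('a \<Rightarrow> 'e) \<Rightarrow> 'e) \<Rightarrow> ('a \<Rightarrow> 'e \<Rightarrow> 'e \<Rightarrow> real) \<Rightarrow> bool" where
  "parallel_tensor2 ch nab T \<longleftrightarrow>
     (\<forall>W Y Z. open W \<and> smooth_vf_on ch W Y \<and> smooth_vf_on ch W Z \<longrightarrow>
        (\<forall>p\<in>W. \<forall>v. dfun ch (\<lambda>q. T q (Y q) (Z q)) p v
                    - T p (nab p v Y) (Z p) - T p (Y p) (nab p v Z) = 0))"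

section \<open>Paracosymplectic manifolds\<close>

definition almost_paracontact ::
  "nat \<Rightarrow> ('a::{t2_space,second_countable_topology}, 'e::euclidean_space) atlas \<Rightarrow>
   ('a \<Rightarrow> 'e \<Rightarrow> 'e) \<Rightarrow> ('a \<Rightarrow> 'e) \<Rightarrow> ('a \<Rightarrow> 'e \<Rightarrow> real) \<Rightarrow> bool" where
  "almost_paracontact m ch \<phi> \<xi> \<eta> \<longleftrightarrow>
     smooth_manifold ch \<and> DIM('e) = 2 * m + 1 \<and>
     (\<forall>p. linear (\<phi> p)) \<and>
     (\<forall>W X. open W \<and> smooth_vf_on ch W X \<longrightarrow> smooth_vf_on ch W (\<lambda>q. \<phi> q (X q))) \<and>
     smooth_vf_on ch UNIV \<xi> \<and>
     (\<forall>p. linear (\<eta> p)) \<and>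
     (\<forall>W X. open W \<and> smooth_vf_on ch W X \<longrightarrow> smooth_fun_on ch W (\<lambda>q. \<eta> q (X q))) \<and>
     (\<forall>p v. \<phi> p (\<phi> p v) = v - \<eta> p v *\<^sub>R \<xi> p) \<and>
     (\<forall>p. \<eta> p (\<xi> p) = 1) \<and>
     (\<forall>p. dim {v. \<eta> p v = 0 \<and> \<phi> p v = v} = m) \<and>
     (\<forall>p. dim {v. \<eta> p v = 0 \<and> \<phi> p v = - v} = m)"

definition almost_paracontact_metric ::
  "nat \<Rightarrow> ('a::{t2_space,second_countable_topology}, 'e::euclidean_space) atlas \<Rightarrow>
   ('a \<Rightarrow> 'e \<Rightarrow> 'e) \<Rightarrow> ('a \<Rightarrow> 'e) \<Rightarrow> ('a \<Rightarrow> 'e \<Rightarrow> real) \<Rightarrow> ('a \<Rightarrow> 'e \<Rightarrow> 'e \<Rightarrow> real) \<Rightarrow> bool" where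
  "almost_paracontact_metric m ch \<phi> \<xi> \<eta> g \<longleftrightarrow>
     almost_paracontact m ch \<phi> \<xi> \<eta> \<and> pseudo_riemannian ch g \<and>
     (\<forall>p u v. g p u v = - g p (\<phi> p u) (\<phi> p v) + \<eta> p u * \<eta> p v)"

text \<open>The existential quantifier is harmless: the Levi-Civita connection exists and is unique.\<close>

definition paracosymplectic ::
  "nat \<Rightarrow> ('a::{t2_space,second_countable_topology}, 'e::euclidean_space) atlas \<Rightarrow>
   ('a \<Rightarrow> 'e \<Rightarrow> 'e) \<Rightarrow> ('a \<Rightarrow> 'e) \<Rightarrow> ('a \<Rightarrow> 'e \<Rightarrow> real) \<Rightarrow> ('a \<Rightarrow> 'e \<Rightarrow> 'e \<Rightarrow> real) \<Rightarrow> bool" where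
  "paracosymplectic m ch \<phi> \<xi> \<eta> g \<longleftrightarrow>
     almost_paracontact_metric m ch \<phi> \<xi> \<eta> g \<and>
     (\<exists>nab. levi_civita ch g nab \<and> parallel_form ch nab \<eta> \<and>
        parallel_tensor2 ch nab (\<lambda>p u v. g p u (\<phi> p v)))"

section \<open>Submanifolds\<close>

definition isometric_immersion ::
  "('b::{t2_space,second_countable_topology}, 'f::euclidean_space) atlas \<Rightarrow>
   ('b \<Rightarrow> 'f \<Rightarrow> 'f \<Rightarrow> real) \<Rightarrow>
   ('a::{t2_space,second_countable_topology}, 'e::euclidean_space) atlas \<Rightarrow>
   ('a \<Rightarrow> 'e \<Rightarrow> 'e \<Rightarrow> real) \<Rightarrow> ('b \<Rightarrow> 'a) \<Rightarrow> bool" where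
  "isometric_immersion chM gM ch g \<iota> \<longleftrightarrow> immersion chM ch \<iota> \<and>
     (\<forall>p u v. gM p u v = g (\<iota> p) (differential chM ch \<iota> p u) (differential chM ch \<iota> p v))"

definition invariant_submanifold ::
  "('b::{t2_space,second_countable_topology}, 'f::euclidean_space) atlas \<Rightarrow>
   ('a::{t2_space,second_countable_topology}, 'e::euclidean_space) atlas \<Rightarrow>
   ('a \<Rightarrow> 'e \<Rightarrow> 'e) \<Rightarrow> ('b \<Rightarrow> 'a) \<Rightarrow> bool" where
  "invariant_submanifold chN ch \<phi> \<iota> \<longleftrightarrow> immersion chN ch \<iota> \<and>
     (\<forall>p u. \<phi> (\<iota> p) (differential chN ch \<iota> p u) \<in> range (differential chN ch \<iota> p))"

definition anti_invariant_submanifold ::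
  "('b::{t2_space,second_countable_topology}, 'f::euclidean_space) atlas \<Rightarrow>
   ('a::{t2_space,second_countable_topology}, 'e::euclidean_space) atlas \<Rightarrow>
   ('a \<Rightarrow> 'e \<Rightarrow> 'e) \<Rightarrow> ('a \<Rightarrow> 'e \<Rightarrow> 'e \<Rightarrow> real) \<Rightarrow> ('b \<Rightarrow> 'a) \<Rightarrow> bool" where
  "anti_invariant_submanifold chN ch \<phi> g \<iota> \<longleftrightarrow> immersion chN ch \<iota> \<and>
     (\<forall>p u v. g (\<iota> p) (\<phi> (\<iota> p) (differential chN ch \<iota> p u)) (differential chN ch \<iota> p v) = 0)"

subsection \<open>Distributions and integrability\<close>

definition distribution ::
  "('a::{t2_space,second_countable_topology}, 'e::euclidean_space) atlas \<Rightarrow>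
   ('a \<Rightarrow> 'e set) \<Rightarrow> bool" where
  "distribution ch D \<longleftrightarrow>
     (\<exists>k. \<forall>p. subspace (D p) \<and> dim (D p) = k \<and>
        (\<exists>W X. open W \<and> p \<in> W \<and> (\<forall>i<k. smooth_vf_on ch W (X i)) \<and>
           (\<forall>q\<in>W. D q = span ((\<lambda>i. X i q) ` {..<k}))))"

text \<open>
  \<open>S\<close> is an integral manifold of \<open>D\<close>: around each \<open>p \<in> S\<close> there is a chart \<open>(U, \<psi>)\<close> of the maximal
  atlas in which \<open>S\<close> is the slice through \<open>\<psi> p\<close> parallel to a linear subspace \<open>V\<close>, so that \<open>S\<close> is a
  submanifold with tangent space \<open>(d\<psi>\<^sub>p)\<^sup>-\<^sup>1(V)\<close> at \<open>p\<close>, and this tangent space is \<open>D p\<close>.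
\<close>

definition integral_manifold ::
  "('a::{t2_space,second_countable_topology}, 'e::euclidean_space) atlas \<Rightarrow>
   ('a \<Rightarrow> 'e set) \<Rightarrow> 'a set \<Rightarrow> bool" where
  "integral_manifold ch D S \<longleftrightarrow>
     (\<forall>p\<in>S. \<exists>U \<psi> V. compatible_chart ch (U, \<psi>) \<and> p \<in> U \<and> subspace V \<and>
        \<psi> ` (U \<inter> S) = {x \<in> \<psi> ` U. x - \<psi> p \<in> V} \<and>
        D p = {v. dfun ch \<psi> p v \<in> V})"

text \<open>
  Embedded integral manifolds are no restriction here, because an immersed one is embedded near
  each of its points in its own topology.
\<close>

definition integrable_distribution ::
  "('a::{t2_space,second_countable_topology}, 'e::euclidean_space) atlas \<Rightarrow>
   ('a \<Rightarrow> 'e set) \<Rightarrow> bool" where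
  "integrable_distribution ch D \<longleftrightarrow> (\<forall>p. \<exists>S. p \<in> S \<and> integral_manifold ch D S)"

section \<open>PR-semi-invariant submanifolds and warped products\<close>

text \<open>
  The direct sum \<open>TM = D \<oplus> D\<^sup>\<bottom> \<oplus> \<langle>\<xi>\<rangle>\<close> is orthogonal, as usual for semi-invariant
  submanifolds; it entails that \<open>\<xi>\<close> is tangent to \<open>M\<close>, and \<open>z\<close> is \<open>\<xi>\<close> seen as a vector of \<open>TM\<close>.
  Distributions on \<open>M\<close> are carried to the ambient manifold by the differential of \<open>\<iota>\<close>.
\<close>

definition PR_semi_invariant ::
  "('a::{t2_space,second_countable_topology}, 'e::euclidean_space) atlas \<Rightarrow>
   ('a \<Rightarrow> 'e \<Rightarrow> 'e) \<Rightarrow> ('a \<Rightarrow> 'e) \<Rightarrow> ('a \<Rightarrow> 'e \<Rightarrow> 'e \<Rightarrow> real) \<Rightarrow>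
   ('b::{t2_space,second_countable_topology}, 'f::euclidean_space) atlas \<Rightarrow>
   ('b \<Rightarrow> 'f \<Rightarrow> 'f \<Rightarrow> real) \<Rightarrow> ('b \<Rightarrow> 'a) \<Rightarrow> ('b \<Rightarrow> 'f set) \<Rightarrow> ('b \<Rightarrow> 'f set) \<Rightarrow> bool" where
  "PR_semi_invariant ch \<phi> \<xi> g chM gM \<iota> D Dp \<longleftrightarrow>
     pseudo_riemannian chM gM \<and> isometric_immersion chM gM ch g \<iota> \<and>
     distribution chM D \<and> distribution chM Dp \<and>
     (\<forall>p. \<exists>z. differential chM ch \<iota> p z = \<xi> (\<iota> p) \<and>
        (\<forall>a\<in>D p. \<forall>b\<in>Dp p. gM p a b = 0) \<and>
        (\<forall>a\<in>D p. gM p a z = 0) \<and> (\<forall>b\<in>Dp p. gM p b z = 0) \<and>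
        (\<forall>v. \<exists>!(a, b, t). a \<in> D p \<and> b \<in> Dp p \<and> v = a + b + t *\<^sub>R z)) \<and>
     (\<forall>p. \<phi> (\<iota> p) ` (differential chM ch \<iota> p ` D p) = differential chM ch \<iota> p ` D p) \<and>
     (\<forall>p. \<forall>b\<in>Dp p. \<forall>v.
        g (\<iota> p) (\<phi> (\<iota> p) (differential chM ch \<iota> p b)) (differential chM ch \<iota> p v) = 0)"

definition warped_metric ::
  "('a \<Rightarrow> real) \<Rightarrow> ('a \<Rightarrow> 'e \<Rightarrow> 'e \<Rightarrow> real) \<Rightarrow> ('b \<Rightarrow> 'f \<Rightarrow> 'f \<Rightarrow> real) \<Rightarrow>
   'a \<times> 'b \<Rightarrow> 'e \<times> 'f \<Rightarrow> 'e \<times> 'f \<Rightarrow> real" where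
  "warped_metric f g1 g2 = (\<lambda>(x, y) (u, w) (u', w'). g1 x u u' + (f x)\<^sup>2 * g2 y w w')"

text \<open>
  \<open>F \<times>\<^sub>f B\<close> as a PR-semi-invariant warped product submanifold, immersed by \<open>\<iota>\<close>. The factors are
  regarded as submanifolds of the ambient manifold through the leaves \<open>F \<times> {y}\<close> and \<open>{x} \<times> B\<close>.
\<close>

definition PR_semi_invariant_warped_product ::
  "('a::{t2_space,second_countable_topology}, 'e::euclidean_space) atlas \<Rightarrow>
   ('a \<Rightarrow> 'e \<Rightarrow> 'e) \<Rightarrow> ('a \<Rightarrow> 'e) \<Rightarrow> ('a \<Rightarrow> 'e \<Rightarrow> 'e \<Rightarrow> real) \<Rightarrow>
   ('b::{t2_space,second_countable_topology}, 'f::euclidean_space) atlas \<Rightarrow>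
   ('b \<Rightarrow> 'f \<Rightarrow> 'f \<Rightarrow> real) \<Rightarrow>
   ('c::{t2_space,second_countable_topology}, 'h::euclidean_space) atlas \<Rightarrow>
   ('c \<Rightarrow> 'h \<Rightarrow> 'h \<Rightarrow> real) \<Rightarrow>
   ('b \<Rightarrow> real) \<Rightarrow> ('b \<times> 'c \<Rightarrow> 'a) \<Rightarrow> ('b \<times> 'c \<Rightarrow> ('f \<times> 'h) set) \<Rightarrow> ('b \<times> 'c \<Rightarrow> ('f \<times> 'h) set) \<Rightarrow> bool"
  where
  "PR_semi_invariant_warped_product ch \<phi> \<xi> g chF gF chB gB f \<iota> D Dp \<longleftrightarrow>
     pseudo_riemannian chF gF \<and> pseudo_riemannian chB gB \<and>
     smooth_fun_on chF UNIV f \<and> (\<forall>x. f x > 0) \<and> \<not> (\<exists>c. \<forall>x. f x = c) \<and>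
     PR_semi_invariant ch \<phi> \<xi> g (prod_atlas chF chB) (warped_metric f gF gB) \<iota> D Dp \<and>
     (\<forall>x. invariant_submanifold chB ch \<phi> (\<lambda>y. \<iota> (x, y))) \<and>
     (\<forall>y. anti_invariant_submanifold chF ch \<phi> g (\<lambda>x. \<iota> (x, y)))"

definition tangent_to_first_factor ::
  "('a::{t2_space,second_countable_topology}, 'e::euclidean_space) atlas \<Rightarrow> ('a \<Rightarrow> 'e) \<Rightarrow>
   ('b::{t2_space,second_countable_topology}, 'f::euclidean_space) atlas \<Rightarrow>
   ('b \<times> 'c \<Rightarrow> 'a) \<Rightarrow> bool" where
  "tangent_to_first_factor ch X chF \<iota> \<longleftrightarrow>
     (\<forall>x y. X (\<iota> (x, y)) \<in> range (differential chF ch (\<lambda>x'. \<iota> (x', y)) x))"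

end

theory Submission
  imports Defs
begin

text \<open>
  Pointwise algebra identifies the two distributions with the product structure. Since \<open>\<phi>\<close> is skew
  for \<open>g\<close> and \<open>\<phi> \<xi> = 0\<close>, a vector tangent to \<open>B\<close> has no component in \<open>D\<^sup>\<bottom>\<close> or along \<open>\<xi>\<close>, and a
  vector of \<open>D\<close> tangent to \<open>F\<close> is killed by \<open>\<phi>\<close>; hence \<open>D = TB\<close> and \<open>D\<^sup>\<bottom> = ker \<eta> \<inter> TF\<close>. The
  leaves of \<open>D\<close> are the slices \<open>{x} \<times> B\<close>. For \<open>D\<^sup>\<bottom>\<close>, a parallel 1-form is closed because the
  connection is torsion free, so \<open>\<eta>\<close> has local primitives; the leaves are the level sets, inside
  the slices \<open>F \<times> {y}\<close>, of their pull-backs to \<open>F \<times> B\<close>, which are regular because \<open>\<xi>\<close> is tangent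
  to \<open>F\<close> and \<open>\<eta>(\<xi>) = 1\<close>.
\<close>

section \<open>Smooth maps between Euclidean spaces\<close>

text \<open>Integrability is defined by slice charts of the maximal atlas, so it is not enough to
  check brackets: charts have to be exhibited. For \<open>D\<close> the product charts already
  serve. For \<open>Dp\<close> one coordinate has to be replaced: inside a slice
  \<open>snd = const\<close> the leaf is cut out by one equation \<open>h = const\<close>. The map
  \<open>z + (h z - \<Lambda> z) *\<^sub>R N\<close>, with \<open>\<Lambda>\<close> the differential
  of \<open>h\<close> at the base point and \<open>N\<close> a vector of the first factor with
  \<open>\<Lambda> N = 1\<close>, turns \<open>h\<close> into a linear coordinate and leaves the
  coordinates of the second factor alone.

  The primitive of \<eta> is found on the ambient manifold, where the torsion-free connection lives,
  and is pulled back by composition.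

  A tangent vector is recorded in the chart distinguished at its own base point, so even a field
  with constant components in one chart has values that involve transition derivatives. The fields
  \<open>coord_field\<close> absorb this: their brackets vanish by symmetry of second derivatives,
  and closedness of \<eta> becomes an equality of partial derivatives in one fixed chart, to which
  the Poincare lemma applies.\<close>

lemma Ck_on_SucD: "Ck_on (Suc k) S f \<Longrightarrow> Ck_on k S f"
proof (induction k arbitrary: f)
  case 0
  then show ?case
    by (auto intro!: continuous_at_imp_continuous_on differentiable_imp_continuous_within)
next
  case (Suc k)
  from Suc.prems have "f differentiable at x" if "x \<in> S" for x
    using that by simp
  moreover from Suc.prems have "Ck_on (Suc k) S (\<lambda>x. frechet_derivative f (at x) v)" for v
    by (simp only: Ck_on.simps(2)[of "Suc k"])
  ultimately show ?case using Suc.IH by (simp only: Ck_on.simps(2)[of k]) blast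
qed

lemma Ck_on_subset: "Ck_on k S f \<Longrightarrow> T \<subseteq> S \<Longrightarrow> Ck_on k T f"
  by (induction k arbitrary: f) (auto intro: continuous_on_subset)

text \<open>A Frechet derivative sees a whole neighbourhood of the point, so agreement on
  \<open>S\<close> passes to derivatives because \<open>S\<close> is open.\<close>

lemma Ck_on_cong:
  assumes "open S" "\<And>x. x \<in> S \<Longrightarrow> f x = g x" "Ck_on k S f"
  shows "Ck_on k S g"
  using assms(2,3)
proof (induction k arbitrary: f g)
  case 0
  then show ?case by (simp cong: continuous_on_cong)
next
  case (Suc k)
  have df: "f differentiable at x" if "x \<in> S" for x
    using Suc.prems(2) that by simp
  have d: "g differentiable at x" if "x \<in> S" for x
    using has_derivative_transform_within_open[of f _ x UNIV S g] assms(1) that Suc.prems(1) df[OF that]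
    unfolding differentiable_def by blast
  have e: "frechet_derivative f (at x) = frechet_derivative g (at x)" if "x \<in> S" for x
    by (rule frechet_derivative_transform_within_open[OF df[OF that] assms(1) that Suc.prems(1)])
  show ?case
    using d Suc.IH[of "\<lambda>x. frechet_derivative f (at x) _"] e Suc.prems(2) by simp
qed

text \<open>Uniqueness of derivatives lets an explicit formula \<open>f'\<close> replace the choice
  made by \<open>frechet_derivative\<close>; the closure properties below are proved through such
  formulas.\<close>

lemma Ck_on_SucI:
  assumes "open S" "\<And>x. x \<in> S \<Longrightarrow> (f has_derivative f' x) (at x)" "\<And>v. Ck_on k S (\<lambda>x. f' x v)"
  shows "Ck_on (Suc k) S f"
proof -
  have "f' x = frechet_derivative f (at x)" if "x \<in> S" for x
    using assms(2) that frechet_derivative_at by blast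
  then have "Ck_on k S (\<lambda>x. frechet_derivative f (at x) v)" for v
    by (intro Ck_on_cong[OF assms(1) _ assms(3)[of v]]) auto
  moreover have "f differentiable at x" if "x \<in> S" for x
    using assms(2)[OF that] unfolding differentiable_def by blast
  ultimately show ?thesis by simp
qed

lemma Ck_on_Suc_has_derivative:
  "Ck_on (Suc k) S f \<Longrightarrow> x \<in> S \<Longrightarrow> (f has_derivative frechet_derivative f (at x)) (at x)"
  by (simp add: frechet_derivative_works)

lemma Ck_on_const [simp]: "Ck_on k S (\<lambda>x. c)"
  by (induction k arbitrary: c) auto

lemma Ck_on_bounded_linear:
  assumes "bounded_linear L" shows "Ck_on k S L"
proof -
  have "(L has_derivative L) (at x)" for x
    using assms by (rule bounded_linear_imp_has_derivative)
  then have "frechet_derivative L (at x) = L" "L differentiable at x" for x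
    using frechet_derivative_at by (metis, auto simp: differentiable_def)
  with assms show ?thesis by (cases k) (auto intro: linear_continuous_on)
qed

lemma Ck_on_linear_compose:
  assumes "open S" "bounded_linear L" "Ck_on k S f"
  shows "Ck_on k S (\<lambda>x. L (f x))"
  using assms(3)
proof (induction k arbitrary: f)
  case 0
  then show ?case using bounded_linear.continuous_on[OF assms(2)] by simp
next
  case (Suc k)
  show ?case
  proof (rule Ck_on_SucI[OF assms(1)])
    show "((\<lambda>x. L (f x)) has_derivative (\<lambda>v. L (frechet_derivative f (at x) v))) (at x)"
      if "x \<in> S" for x
      by (rule bounded_linear.has_derivative[OF assms(2) Ck_on_Suc_has_derivative[OF Suc.prems that]])
  qed (use Suc in auto)
qed

lemma Ck_on_add:
  assumes "open S" "Ck_on k S f" "Ck_on k S g"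
  shows "Ck_on k S (\<lambda>x. f x + g x)"
  using assms(2,3)
proof (induction k arbitrary: f g)
  case 0
  then show ?case by (auto intro: continuous_on_add)
next
  case (Suc k)
  show ?case
    by (rule Ck_on_SucI[OF assms(1) has_derivative_add])
      (use Suc in \<open>auto intro: Ck_on_Suc_has_derivative\<close>)
qed

lemma Ck_on_sum:
  assumes "open S" "\<And>i. i \<in> I \<Longrightarrow> Ck_on k S (f i)"
  shows "Ck_on k S (\<lambda>x. \<Sum>i\<in>I. f i x)"
  using assms(2)
  by (induction I rule: infinite_finite_induct) (auto intro: Ck_on_add assms(1))

lemma Ck_on_scaleR:
  assumes "open S" "Ck_on k S f" "Ck_on k S g"
  shows "Ck_on k S (\<lambda>x. f x *\<^sub>R g x)"
  using assms(2,3)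
proof (induction k arbitrary: f g)
  case 0
  then show ?case by (auto intro: continuous_on_scaleR)
next
  case (Suc k)
  show ?case
  proof (rule Ck_on_SucI[OF assms(1) has_derivative_scaleR])
    fix v
    show "Ck_on k S (\<lambda>x. f x *\<^sub>R frechet_derivative g (at x) v + frechet_derivative f (at x) v *\<^sub>R g x)"
      using Suc.prems Ck_on_SucD[OF Suc.prems(1)] Ck_on_SucD[OF Suc.prems(2)]
      by (intro Ck_on_add[OF assms(1)] Suc.IH) simp_all
  qed (use Suc in \<open>auto intro: Ck_on_Suc_has_derivative\<close>)
qed

text \<open>The induction varies \<open>g\<close> and keeps \<open>f\<close>: the hypothesis is
  applied to the directional derivatives of \<open>g\<close>, with \<open>f\<close> demoted by one
  order.\<close>

lemma Ck_on_compose: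
  assumes "open S" "open T" "f ` S \<subseteq> T" "Ck_on k S f" "Ck_on k T g"
  shows "Ck_on k S (\<lambda>x. g (f x))"
  using assms(4,5)
proof (induction k arbitrary: g)
  case 0
  then show ?case using assms(3) by (auto intro: continuous_on_compose2)
next
  case (Suc k)
  show ?case
  proof (rule Ck_on_SucI[OF assms(1)])
    fix x assume x: "x \<in> S"
    have "(g has_derivative frechet_derivative g (at (f x))) (at (f x))"
      using Ck_on_Suc_has_derivative[OF Suc.prems(2)] assms(3) x by auto
    with Ck_on_Suc_has_derivative[OF Suc.prems(1) x]
    have comp: "((\<lambda>x. g (f x)) has_derivative
        (\<lambda>v. frechet_derivative g (at (f x)) (frechet_derivative f (at x) v))) (at x)"
      by (rule has_derivative_compose)
    have lin: "linear (frechet_derivative g (at (f x)))"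
      using Suc.prems(2) assms(3) x by (intro linear_frechet_derivative) auto
    \<comment> \<open>In the chain rule the outer derivative acts on a direction that moves with
      \<open>x\<close>. Expanding that direction in the basis leaves only fixed directions, which is
      the form that \<open>Ck_on\<close> controls.\<close>
    have rep: "frechet_derivative g (at (f x)) w
        = (\<Sum>b\<in>Basis. (w \<bullet> b) *\<^sub>R frechet_derivative g (at (f x)) b)" for w
      using linear_sum[OF lin, of "\<lambda>b. (w \<bullet> b) *\<^sub>R b" Basis]
      by (simp add: linear_scale[OF lin] euclidean_representation)
    show "((\<lambda>x. g (f x)) has_derivative
        (\<lambda>v. \<Sum>b\<in>Basis. (frechet_derivative f (at x) v \<bullet> b) *\<^sub>R frechet_derivative g (at (f x)) b)) (at x)"
      by (rule has_derivative_eq_rhs[OF comp]) (rule ext, rule rep)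
  next
    fix v
    have "Ck_on k S (\<lambda>x. frechet_derivative g (at (f x)) b)" for b
      using Suc.prems(2) by (intro Suc.IH[OF Ck_on_SucD[OF Suc.prems(1)]]) simp
    moreover have "Ck_on k S (\<lambda>x. frechet_derivative f (at x) v \<bullet> b)" for b
      using Suc.prems(1) by (intro Ck_on_linear_compose[OF assms(1) bounded_linear_inner_left]) simp
    ultimately show "Ck_on k S (\<lambda>x. \<Sum>b\<in>Basis. (frechet_derivative f (at x) v \<bullet> b) *\<^sub>R
        frechet_derivative g (at (f x)) b)"
      by (intro Ck_on_sum[OF assms(1)] Ck_on_scaleR[OF assms(1)])
  qed
qed

text \<open>The derivative of the reciprocal contains the reciprocal itself, but only to the order
  already reached, so the induction closes.\<close>

lemma Ck_on_inverse:
  fixes f :: "'e::euclidean_space \<Rightarrow> real"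
  assumes "open S" "Ck_on k S f" "\<And>x. x \<in> S \<Longrightarrow> f x \<noteq> 0"
  shows "Ck_on k S (\<lambda>x. inverse (f x))"
  using assms(2)
proof (induction k)
  case 0
  then show ?case using continuous_on_inverse[of S f] assms(3) by simp
next
  case (Suc k)
  show ?case
  proof (rule Ck_on_SucI[OF assms(1)])
    show "((\<lambda>x. inverse (f x)) has_derivative
      (\<lambda>v. - (inverse (f x) *\<^sub>R (frechet_derivative f (at x) v *\<^sub>R inverse (f x))))) (at x)"
      if "x \<in> S" for x
      using Deriv.has_derivative_inverse[OF assms(3)[OF that] Ck_on_Suc_has_derivative[OF Suc.prems that]]
      by (simp add: mult.assoc)
  next
    have inv: "Ck_on k S (\<lambda>x. inverse (f x))"
      using Suc.IH Ck_on_SucD[OF Suc.prems] by blast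
    show "Ck_on k S (\<lambda>x. - (inverse (f x) *\<^sub>R (frechet_derivative f (at x) v *\<^sub>R inverse (f x))))" for v
      using Suc.prems
      by (intro Ck_on_linear_compose[OF assms(1) bounded_linear_minus[OF bounded_linear_ident]]
            Ck_on_scaleR[OF assms(1)] inv) simp
  qed
qed

section \<open>Smoothness of infinite order\<close>

lemma smooth_on_Ck: "smooth_on S f \<Longrightarrow> Ck_on k S f"
  by (simp add: smooth_on_def)

lemma smooth_on_subset: "smooth_on S f \<Longrightarrow> T \<subseteq> S \<Longrightarrow> smooth_on T f"
  unfolding smooth_on_def using Ck_on_subset by blast

lemma smooth_on_cong:
  "open S \<Longrightarrow> (\<And>x. x \<in> S \<Longrightarrow> f x = g x) \<Longrightarrow> smooth_on S f \<Longrightarrow> smooth_on S g"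
  by (auto simp: smooth_on_def intro: Ck_on_cong)

lemma smooth_on_compose:
  assumes "open S" "open T" "f ` S \<subseteq> T" "smooth_on S f" "smooth_on T g"
  shows "smooth_on S (\<lambda>x. g (f x))"
  unfolding smooth_on_def
  using Ck_on_compose[OF assms(1-3)] smooth_on_Ck[OF assms(4)] smooth_on_Ck[OF assms(5)] by blast

lemma smooth_on_continuous: "smooth_on S f \<Longrightarrow> continuous_on S f"
  using smooth_on_Ck[of S f 0] by simp

lemma smooth_on_has_derivative:
  "smooth_on S f \<Longrightarrow> x \<in> S \<Longrightarrow> (f has_derivative frechet_derivative f (at x)) (at x)"
  using Ck_on_Suc_has_derivative smooth_on_Ck by blast

lemma smooth_on_frechet_derivative:
  "smooth_on S f \<Longrightarrow> smooth_on S (\<lambda>x. frechet_derivative f (at x) v)"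
  using Ck_on.simps(2) unfolding smooth_on_def by blast

lemma smooth_on_has_derivativeI:
  assumes "open S" "\<And>x. x \<in> S \<Longrightarrow> (f has_derivative f' x) (at x)" "\<And>v. smooth_on S (\<lambda>x. f' x v)"
  shows "smooth_on S f"
proof -
  have "Ck_on (Suc k) S f" for k
    using assms by (intro Ck_on_SucI[of S f f']) (auto simp: smooth_on_def)
  then show ?thesis by (auto simp: smooth_on_def intro: Ck_on_SucD)
qed

section \<open>Symmetry of second derivatives and the Poincare lemma\<close>

text \<open>The mean value theorem is used twice: along \<open>u\<close> for the difference of
  \<open>f\<close> across the side \<open>s *\<^sub>R v\<close>, then along \<open>v\<close> for the
  resulting derivative. The left-hand side is symmetric in \<open>u\<close> and \<open>v\<close>, so
  exchanging them yields the other mixed derivative.\<close>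

lemma second_difference_mean_value:
  fixes f :: "'e::euclidean_space \<Rightarrow> real"
  assumes f: "\<And>y. y \<in> S \<Longrightarrow> f differentiable at y"
    and df: "\<And>y. y \<in> S \<Longrightarrow> (\<lambda>y. frechet_derivative f (at y) u) differentiable at y"
    and s: "s > 0"
    and S: "\<And>a b. 0 \<le> a \<Longrightarrow> a \<le> s \<Longrightarrow> 0 \<le> b \<Longrightarrow> b \<le> s \<Longrightarrow> x + a *\<^sub>R u + b *\<^sub>R v \<in> S"
  obtains a b where "0 \<le> a" "a \<le> s" "0 \<le> b" "b \<le> s"
    "f (x + s *\<^sub>R u + s *\<^sub>R v) - f (x + s *\<^sub>R u) - f (x + s *\<^sub>R v) + f x =
      s\<^sup>2 * frechet_derivative (\<lambda>y. frechet_derivative f (at y) u) (at (x + a *\<^sub>R u + b *\<^sub>R v)) v"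
proof -
  let ?D = "\<lambda>y. frechet_derivative f (at y)"
  let ?\<phi> = "\<lambda>a. f (x + a *\<^sub>R u + s *\<^sub>R v) - f (x + a *\<^sub>R u)"
  have d1: "((\<lambda>a. f (x + a *\<^sub>R u + b *\<^sub>R v)) has_real_derivative ?D (x + a *\<^sub>R u + b *\<^sub>R v) u) (at a)"
    if "0 \<le> a" "a \<le> s" "0 \<le> b" "b \<le> s" for a b
  proof -
    have fd: "(f has_derivative ?D (x + a *\<^sub>R u + b *\<^sub>R v)) (at (x + a *\<^sub>R u + b *\<^sub>R v))"
      using f S[OF that] frechet_derivative_works by blast
    have "((\<lambda>a. x + a *\<^sub>R u + b *\<^sub>R v) has_derivative (\<lambda>h. h *\<^sub>R u)) (at a)"
      by (auto intro!: derivative_eq_intros)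
    from has_derivative_compose[OF this fd] show ?thesis
      using linear_scale[OF has_derivative_linear[OF fd]]
      by (simp add: has_field_derivative_def mult_commute_abs)
  qed
  have "\<exists>a>0. a < s \<and> ?\<phi> s - ?\<phi> 0 = (s - 0) * (?D (x + a *\<^sub>R u + s *\<^sub>R v) u - ?D (x + a *\<^sub>R u) u)"
    using d1[of _ s] d1[of _ 0] s by (intro MVT2) (auto intro!: DERIV_diff)
  then obtain a where a: "0 < a" "a < s"
    "?\<phi> s - ?\<phi> 0 = s * (?D (x + a *\<^sub>R u + s *\<^sub>R v) u - ?D (x + a *\<^sub>R u) u)" by auto
  let ?E = "\<lambda>y. frechet_derivative (\<lambda>y. ?D y u) (at y)"
  have d2: "((\<lambda>b. ?D (x + a *\<^sub>R u + b *\<^sub>R v) u) has_real_derivative ?E (x + a *\<^sub>R u + b *\<^sub>R v) v) (at b)"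
    if "0 \<le> b" "b \<le> s" for b
  proof -
    have fd: "((\<lambda>y. ?D y u) has_derivative ?E (x + a *\<^sub>R u + b *\<^sub>R v)) (at (x + a *\<^sub>R u + b *\<^sub>R v))"
      using df S[OF _ _ that, of a] a frechet_derivative_works by force
    have "((\<lambda>b. x + a *\<^sub>R u + b *\<^sub>R v) has_derivative (\<lambda>h. h *\<^sub>R v)) (at b)"
      by (auto intro!: derivative_eq_intros)
    from has_derivative_compose[OF this fd] show ?thesis
      using linear_scale[OF has_derivative_linear[OF fd]]
      by (simp add: has_field_derivative_def mult_commute_abs)
  qed
  have "\<exists>b>0. b < s \<and> ?D (x + a *\<^sub>R u + s *\<^sub>R v) u - ?D (x + a *\<^sub>R u + 0 *\<^sub>R v) u
      = (s - 0) * ?E (x + a *\<^sub>R u + b *\<^sub>R v) v"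
    using d2 s by (intro MVT2) auto
  then obtain b where "0 < b" "b < s"
    "?D (x + a *\<^sub>R u + s *\<^sub>R v) u - ?D (x + a *\<^sub>R u) u = s * ?E (x + a *\<^sub>R u + b *\<^sub>R v) v" by auto
  with a show ?thesis
    by (intro that[of a b]) (auto simp: power2_eq_square algebra_simps)
qed

text \<open>Both mixed derivatives, taken at suitable points of one small parallelogram at
  \<open>x\<close>, equal the same second difference divided by \<open>s\<^sup>2\<close>. Continuity
  forbids this if they differ at \<open>x\<close>.\<close>

lemma frechet_derivative_commute_real:
  fixes f :: "'e::euclidean_space \<Rightarrow> real"
  assumes S: "open S" "x \<in> S" and f: "Ck_on 2 S f"
  shows "frechet_derivative (\<lambda>y. frechet_derivative f (at y) u) (at x) v
    = frechet_derivative (\<lambda>y. frechet_derivative f (at y) v) (at x) u"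
proof (rule ccontr)
  let ?A = "\<lambda>y. frechet_derivative (\<lambda>y. frechet_derivative f (at y) u) (at y) v"
  let ?B = "\<lambda>y. frechet_derivative (\<lambda>y. frechet_derivative f (at y) v) (at y) u"
  assume ne: "?A x \<noteq> ?B x"
  have d: "f differentiable at y" "(\<lambda>y. frechet_derivative f (at y) w) differentiable at y"
    if "y \<in> S" for y w
    using f that by (auto simp: numeral_2_eq_2)
  \<comment> \<open>Half the gap: values closer than this to \<open>?A x\<close> and to
    \<open>?B x\<close> cannot coincide.\<close>
  let ?r = "dist (?A x) (?B x) / 2"
  have r: "?r > 0" using ne by simp
  have cont: "continuous_on S ?A" "continuous_on S ?B"
    using f by (auto simp: numeral_2_eq_2)
  obtain e1 where e1: "e1 > 0" "\<And>p. p \<in> S \<Longrightarrow> dist p x < e1 \<Longrightarrow> dist (?A p) (?A x) < ?r"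
    using cont(1) S(2) r unfolding continuous_on_iff by blast
  obtain e2 where e2: "e2 > 0" "\<And>p. p \<in> S \<Longrightarrow> dist p x < e2 \<Longrightarrow> dist (?B p) (?B x) < ?r"
    using cont(2) S(2) r unfolding continuous_on_iff by blast
  obtain e3 where e3: "e3 > 0" "\<And>p. dist p x < e3 \<Longrightarrow> p \<in> S"
    using S unfolding open_dist by blast
  define e where "e = min e1 (min e2 e3)"
  have e: "e > 0" using e1(1) e2(1) e3(1) by (simp add: e_def)
  have E: "p \<in> S \<and> dist (?A p) (?A x) < ?r \<and> dist (?B p) (?B x) < ?r" if "dist p x < e" for p
    using that e1(2)[of p] e2(2)[of p] e3(2)[of p] by (simp add: e_def)
  \<comment> \<open>With \<open>s = e / (2 * c)\<close> the parallelogram stays within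
    \<open>e / 2\<close> of \<open>x\<close>; the summand \<open>1\<close> keeps \<open>c\<close>
    positive when \<open>u\<close> and \<open>v\<close> both vanish.\<close>
  define c where "c = norm u + norm v + 1"
  define s where "s = e / (2 * c)"
  have nz: "c > 0" unfolding c_def using norm_ge_zero[of u] norm_ge_zero[of v] by linarith
  have s: "s > 0" using e nz by (simp add: s_def)
  have near: "dist (x + a *\<^sub>R u + b *\<^sub>R v) x < e" if "0 \<le> a" "a \<le> s" "0 \<le> b" "b \<le> s" for a b
  proof -
    have "dist (x + a *\<^sub>R u + b *\<^sub>R v) x \<le> a * norm u + b * norm v"
      using that norm_triangle_ineq[of "a *\<^sub>R u" "b *\<^sub>R v"] by (simp add: dist_norm)
    also have "\<dots> \<le> s * (norm u + norm v + 1)"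
      using that s mult_right_mono[of a s "norm u"] mult_right_mono[of b s "norm v"]
      by (simp add: algebra_simps)
    also have "\<dots> = e / 2" using nz by (simp add: s_def flip: c_def)
    finally show ?thesis using e by linarith
  qed
  have near': "dist (x + a *\<^sub>R v + b *\<^sub>R u) x < e" if "0 \<le> a" "a \<le> s" "0 \<le> b" "b \<le> s" for a b
    using near[OF that(3,4,1,2)] by (simp add: ac_simps)
  obtain a b where ab: "0 \<le> a" "a \<le> s" "0 \<le> b" "b \<le> s"
    "f (x + s *\<^sub>R u + s *\<^sub>R v) - f (x + s *\<^sub>R u) - f (x + s *\<^sub>R v) + f x = s\<^sup>2 * ?A (x + a *\<^sub>R u + b *\<^sub>R v)"
    using second_difference_mean_value[of S f u s x v, OF d s] near E by blast
  obtain c d where cd: "0 \<le> c" "c \<le> s" "0 \<le> d" "d \<le> s"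
    "f (x + s *\<^sub>R v + s *\<^sub>R u) - f (x + s *\<^sub>R v) - f (x + s *\<^sub>R u) + f x = s\<^sup>2 * ?B (x + c *\<^sub>R v + d *\<^sub>R u)"
    using second_difference_mean_value[of S f v s x u, OF d s] near' E by blast
  have "s\<^sup>2 * ?A (x + a *\<^sub>R u + b *\<^sub>R v) = s\<^sup>2 * ?B (x + d *\<^sub>R u + c *\<^sub>R v)"
    using ab(5) cd(5) by (simp add: algebra_simps)
  then have "?A (x + a *\<^sub>R u + b *\<^sub>R v) = ?B (x + d *\<^sub>R u + c *\<^sub>R v)"
    using s by simp
  moreover note E[OF near[OF ab(1-4)]] E[OF near[OF cd(3,4,1,2)]]
  ultimately show False
    using dist_triangle_half_r[of "?A (x + a *\<^sub>R u + b *\<^sub>R v)" "?A x" "dist (?A x) (?B x)" "?B x"] by auto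
qed

lemma frechet_derivative_commute:
  fixes f :: "'e::euclidean_space \<Rightarrow> 'c::euclidean_space"
  assumes S: "open S" "x \<in> S" and f: "Ck_on 2 S f"
  shows "frechet_derivative (\<lambda>y. frechet_derivative f (at y) u) (at x) v
    = frechet_derivative (\<lambda>y. frechet_derivative f (at y) v) (at x) u"
proof (rule euclidean_eqI)
  fix b :: 'c assume "b \<in> Basis"
  have bl: "bounded_linear (\<lambda>y::'c. y \<bullet> b)" by (rule bounded_linear_inner_left)
  have d1: "((\<lambda>y. f y \<bullet> b) has_derivative (\<lambda>w. frechet_derivative f (at y) w \<bullet> b)) (at y)"
    if "y \<in> S" for y
    using f that unfolding numeral_2_eq_2
    by (intro bounded_linear.has_derivative[OF bl] Ck_on_Suc_has_derivative)
  then have e1: "frechet_derivative (\<lambda>y. f y \<bullet> b) (at y) = (\<lambda>w. frechet_derivative f (at y) w \<bullet> b)"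
    if "y \<in> S" for y
    using that frechet_derivative_at[symmetric] by blast
  have e2: "frechet_derivative (\<lambda>y. frechet_derivative (\<lambda>y. f y \<bullet> b) (at y) w) (at x) w'
    = frechet_derivative (\<lambda>y. frechet_derivative f (at y) w) (at x) w' \<bullet> b" for w w'
  proof -
    have "Ck_on (Suc 0) S (\<lambda>y. frechet_derivative f (at y) w)"
      using f unfolding numeral_2_eq_2 Ck_on.simps(2)[of "Suc 0"] by blast
    from Ck_on_Suc_has_derivative[OF this S(2)]
    have "((\<lambda>y. frechet_derivative f (at y) w \<bullet> b) has_derivative
      (\<lambda>w'. frechet_derivative (\<lambda>y. frechet_derivative f (at y) w) (at x) w' \<bullet> b)) (at x)"
      by (rule bounded_linear.has_derivative[OF bl])
    then have "((\<lambda>y. frechet_derivative (\<lambda>y. f y \<bullet> b) (at y) w) has_derivative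
      (\<lambda>w'. frechet_derivative (\<lambda>y. frechet_derivative f (at y) w) (at x) w' \<bullet> b)) (at x)"
      by (rule has_derivative_transform_within_open[OF _ S]) (simp add: e1)
    then show ?thesis using frechet_derivative_at by metis
  qed
  show "frechet_derivative (\<lambda>y. frechet_derivative f (at y) u) (at x) v \<bullet> b
    = frechet_derivative (\<lambda>y. frechet_derivative f (at y) v) (at x) u \<bullet> b"
    using frechet_derivative_commute_real[OF S Ck_on_linear_compose[OF S(1) bl f], of u v]
    by (simp add: e2)
qed

text \<open>Poincare lemma on a convex set: \<open>H\<close> integrates the form along the segment
  from \<open>x0\<close> to \<open>x\<close>. Closedness turns the \<open>x\<close>-derivative of
  the integrand into the \<open>t\<close>-derivative of \<open>t * A (\<gamma> x t) v\<close>, so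
  the derivative of the integral is a boundary term.\<close>

lemma closed_one_form_has_primitive:
  fixes A :: "'e::euclidean_space \<Rightarrow> 'e \<Rightarrow> real"
  assumes U: "open U" "convex U" "x0 \<in> U"
    and lin: "\<And>x. x \<in> U \<Longrightarrow> linear (A x)"
    and A: "\<And>v. smooth_on U (\<lambda>x. A x v)"
    and closed: "\<And>x u v. x \<in> U \<Longrightarrow>
      frechet_derivative (\<lambda>x. A x u) (at x) v = frechet_derivative (\<lambda>x. A x v) (at x) u"
  obtains H where "\<And>x. x \<in> U \<Longrightarrow> (H has_derivative A x) (at x)" "smooth_on U H"
proof -
  define \<gamma> where "\<gamma> x t = x0 + t *\<^sub>R (x - x0)" for x and t :: real
  have \<gamma>U: "\<gamma> x t \<in> U" if "x \<in> U" "t \<in> {0..1}" for x t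
  proof -
    have "\<gamma> x t = (1 - t) *\<^sub>R x0 + t *\<^sub>R x" by (simp add: \<gamma>_def algebra_simps)
    then show ?thesis using U that by (auto simp: convex_alt)
  qed
  \<comment> \<open>Smoothness of the form is assumed for fixed directions only; varying ones such
    as \<open>x - x0\<close> are reduced to basis vectors.\<close>
  have rep: "A x v = (\<Sum>b\<in>Basis. (v \<bullet> b) * A x b)" if "x \<in> U" for x v
    using linear_sum[OF lin[OF that], of "\<lambda>b. (v \<bullet> b) *\<^sub>R b" Basis]
    by (simp add: linear_scale[OF lin[OF that]] euclidean_representation)
  define dA where "dA x u = frechet_derivative (\<lambda>x. A x u) (at x)" for x u
  have dA: "((\<lambda>x. A x u) has_derivative dA x u) (at x)" if "x \<in> U" for x u
    unfolding dA_def using smooth_on_has_derivative[OF A that] .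
  have lindA: "linear (dA x u)" if "x \<in> U" for x u
    using has_derivative_linear[OF dA[OF that]] .
  have sym: "dA x u v = dA x v u" if "x \<in> U" for x u v
    using closed[OF that] by (simp add: dA_def)
  \<comment> \<open>The derivative of the integrand in direction \<open>v\<close>, with the two
    arguments of \<open>dA\<close> already exchanged by closedness. In this form it is also the
    \<open>t\<close>-derivative of \<open>t * A (\<gamma> x t) v\<close>.\<close>
  define P where "P x t v = t * dA (\<gamma> x t) v (x - x0) + A (\<gamma> x t) v" for x t v
  have P_add: "P x t (v + w) = P x t v + P x t w" if "x \<in> U" "t \<in> {0..1}" for x t v w
    using \<gamma>U[OF that] by (simp add: P_def sym linear_add lindA lin algebra_simps)
  have P_scale: "P x t (c *\<^sub>R v) = c * P x t v" if "x \<in> U" "t \<in> {0..1}" for x t c v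
    using \<gamma>U[OF that] by (simp add: P_def sym linear_scale lindA lin algebra_simps)
  have P_lin: "linear (P x t)" if "x \<in> U" "t \<in> {0..1}" for x t
    using P_add[OF that] P_scale[OF that] by (intro linearI) auto
  \<comment> \<open>Differentiation under the integral takes the derivative as a bounded linear
    function; \<open>Blinfun\<close> is meaningful only where \<open>P x t\<close> is known to be
    linear.\<close>
  have apply_P: "blinfun_apply (Blinfun (P x t)) = P x t" if "x \<in> U" "t \<in> {0..1}" for x t
    using P_lin[OF that] by (intro bounded_linear_Blinfun_apply) (simp add: linear_conv_bounded_linear)
  define f where "f x t = A (\<gamma> x t) (x - x0)" for x t
  define H where "H x = integral {0..1} (f x)" for x
  have contA: "continuous_on U (\<lambda>x. A x v)" for v
    using A smooth_on_continuous by blast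
  have cont\<gamma>: "continuous_on (U \<times> {0..1}) (\<lambda>p. \<gamma> (fst p) (snd p))"
    unfolding \<gamma>_def by (intro continuous_intros)
  have cont\<gamma>': "continuous_on {0..1} (\<gamma> x)" for x
    unfolding \<gamma>_def by (intro continuous_intros)
  have d: "((\<lambda>x. f x t) has_derivative P x t) (at x)" if x: "x \<in> U" and t: "t \<in> {0..1}" for x t
  proof -
    have "((\<lambda>x. \<gamma> x t) has_derivative (\<lambda>v. t *\<^sub>R v)) (at x)"
      unfolding \<gamma>_def by (auto intro!: derivative_eq_intros)
    from has_derivative_compose[OF this dA[OF \<gamma>U[OF that]]]
    have 1: "((\<lambda>x. A (\<gamma> x t) b) has_derivative (\<lambda>v. t * dA (\<gamma> x t) b v)) (at x)" for b
      using linear_scale[OF lindA[OF \<gamma>U[OF that]]] by simp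
    have 2: "((\<lambda>x. (x - x0) \<bullet> b) has_derivative (\<lambda>v. v \<bullet> b)) (at x)" for b
      by (auto intro!: derivative_eq_intros)
    have "((\<lambda>x. \<Sum>b\<in>Basis. ((x - x0) \<bullet> b) * A (\<gamma> x t) b) has_derivative
      (\<lambda>v. \<Sum>b\<in>Basis. ((x - x0) \<bullet> b) * (t * dA (\<gamma> x t) b v) + (v \<bullet> b) * A (\<gamma> x t) b)) (at x)"
      by (intro has_derivative_sum has_derivative_mult[OF 2 1])
    then have "((\<lambda>x. f x t) has_derivative
      (\<lambda>v. \<Sum>b\<in>Basis. ((x - x0) \<bullet> b) * (t * dA (\<gamma> x t) b v) + (v \<bullet> b) * A (\<gamma> x t) b)) (at x)"
      using \<gamma>U[OF _ t] x
      by (elim has_derivative_transform_within_open[OF _ U(1)]) (auto simp: f_def rep[symmetric])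
    moreover have "(\<Sum>b\<in>Basis. ((x - x0) \<bullet> b) * (t * dA (\<gamma> x t) b v) + (v \<bullet> b) * A (\<gamma> x t) b) = P x t v" for v
    proof -
      have "dA (\<gamma> x t) v (x - x0) = (\<Sum>b\<in>Basis. ((x - x0) \<bullet> b) * dA (\<gamma> x t) b v)"
        using linear_sum[OF lindA[OF \<gamma>U[OF that], of v], of "\<lambda>b. ((x - x0) \<bullet> b) *\<^sub>R b" Basis]
        by (simp add: linear_scale[OF lindA[OF \<gamma>U[OF that]]] euclidean_representation
            sym[OF \<gamma>U[OF that], of v])
      then show ?thesis
        by (simp add: P_def sum.distrib sum_distrib_left rep[OF \<gamma>U[OF that], symmetric] mult.left_commute)
    qed
    ultimately show ?thesis by simp
  qed
  have contP: "continuous_on (U \<times> {0..1}) (\<lambda>p. P (fst p) (snd p) v)" for v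
  proof -
    have eq: "P (fst p) (snd p) v = snd p * (\<Sum>b\<in>Basis. ((fst p - x0) \<bullet> b) * dA (\<gamma> (fst p) (snd p)) v b)
        + A (\<gamma> (fst p) (snd p)) v" if "p \<in> U \<times> {0..1}" for p
    proof -
      have "\<gamma> (fst p) (snd p) \<in> U" using \<gamma>U that by auto
      then have "dA (\<gamma> (fst p) (snd p)) v (fst p - x0)
          = (\<Sum>b\<in>Basis. ((fst p - x0) \<bullet> b) * dA (\<gamma> (fst p) (snd p)) v b)"
        using linear_sum[OF lindA, of "\<gamma> (fst p) (snd p)" v "\<lambda>b. ((fst p - x0) \<bullet> b) *\<^sub>R b" Basis]
        by (simp add: linear_scale[OF lindA] euclidean_representation)
      then show ?thesis by (simp add: P_def)
    qed
    have "continuous_on U (\<lambda>x. dA x v b)" for b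
      unfolding dA_def by (intro smooth_on_continuous smooth_on_frechet_derivative A)
    then have "continuous_on (U \<times> {0..1}) (\<lambda>p. snd p * (\<Sum>b\<in>Basis. ((fst p - x0) \<bullet> b) * dA (\<gamma> (fst p) (snd p)) v b)
        + A (\<gamma> (fst p) (snd p)) v)"
      using \<gamma>U by (intro continuous_intros continuous_on_compose2[OF contA cont\<gamma>]
          continuous_on_compose2[of U "\<lambda>x. dA x v _", OF _ cont\<gamma>]) auto
    then show ?thesis using eq by (simp cong: continuous_on_cong)
  qed
  have H: "(H has_derivative A x) (at x)" if x: "x \<in> U" for x
  proof -
    let ?P = "\<lambda>x t. Blinfun (P x t)"
    have cP: "continuous_on (U \<times> cbox 0 1) (\<lambda>(x, t). ?P x t)"
    proof (rule continuous_on_blinfun_componentwise)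
      show "continuous_on (U \<times> cbox 0 1) (\<lambda>p. blinfun_apply (case p of (x, t) \<Rightarrow> ?P x t) i)" for i
        unfolding box_real using contP[of i] by (rule continuous_on_eq) (auto simp: apply_P)
    qed
    have int: "f y integrable_on cbox 0 1" if "y \<in> U" for y
    proof -
      have "continuous_on {0..1} (\<lambda>t. \<Sum>b\<in>Basis. ((y - x0) \<bullet> b) * A (\<gamma> y t) b)"
        using \<gamma>U[OF that] by (intro continuous_intros continuous_on_compose2[OF contA cont\<gamma>']) auto
      then have "continuous_on {0..1} (f y)"
        by (rule continuous_on_eq) (use rep \<gamma>U[OF that] in \<open>auto simp: f_def\<close>)
      then show ?thesis by (auto intro: integrable_continuous_real)
    qed
    have der: "((\<lambda>x. integral (cbox 0 1) (f x)) has_derivative integral (cbox 0 1) (?P x)) (at x within U)"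
      using d apply_P int cP x U
      by (intro leibniz_rule) (auto intro: has_derivative_at_withinI)
    have "integral (cbox 0 1) (?P x) v = A x v" for v
    proof -
      have Px: "continuous_on (cbox 0 1) (\<lambda>t::real. (x, t))" by (intro continuous_intros)
      have "continuous_on (cbox 0 1) (?P x)"
        using continuous_on_compose2[OF cP Px] x by auto
      then have "?P x integrable_on cbox 0 1" by (rule integrable_continuous)
      then have "integral (cbox 0 1) (?P x) v = integral (cbox 0 1) (\<lambda>t. ?P x t v)"
        using integral_linear[of "?P x" "cbox 0 1" "\<lambda>F. blinfun_apply F v"]
        by (simp add: o_def blinfun.bounded_linear_left)
      also have "\<dots> = integral {0..1} (\<lambda>t. P x t v)"
        using apply_P[OF x] by (auto intro: integral_cong)
      \<comment> \<open>Fundamental theorem of calculus: the end \<open>t = 1\<close> gives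
        \<open>A x v\<close>, and the factor \<open>t\<close> removes the end
        \<open>t = 0\<close>.\<close>
      also have "\<dots> = 1 * A (\<gamma> x 1) v - 0 * A (\<gamma> x 0) v"
      proof (rule integral_unique, rule fundamental_theorem_of_calculus)
        fix t :: real assume t: "t \<in> {0..1}"
        have "((\<lambda>t. \<gamma> x t) has_derivative (\<lambda>h. h *\<^sub>R (x - x0))) (at t)"
          unfolding \<gamma>_def by (auto intro!: derivative_eq_intros)
        from has_derivative_compose[OF this dA[OF \<gamma>U[OF x t]]]
        have "((\<lambda>t. A (\<gamma> x t) v) has_derivative (\<lambda>h. h * dA (\<gamma> x t) v (x - x0))) (at t)"
          using linear_scale[OF lindA[OF \<gamma>U[OF x t]]] by simp
        from has_derivative_mult[OF has_derivative_ident this]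
        show "((\<lambda>t. t * A (\<gamma> x t) v) has_vector_derivative P x t v) (at t within {0..1})"
          unfolding has_vector_derivative_def
          by (rule has_derivative_at_withinI[OF has_derivative_eq_rhs])
            (auto simp: P_def algebra_simps)
      qed simp
      finally show ?thesis by (simp add: \<gamma>_def)
    qed
    then have "blinfun_apply (integral (cbox 0 1) (?P x)) = A x" by auto
    with der show ?thesis
      using x U unfolding H_def by (simp add: at_within_open[of x U] box_real)
  qed
  show thesis
    by (rule that[OF H smooth_on_has_derivativeI[OF U(1) H A]])
qed

section \<open>Straightening a function by a diffeomorphism\<close>

lemma smooth_on_const [simp]: "smooth_on S (\<lambda>x. c)"
  by (simp add: smooth_on_def)

lemma smooth_on_bounded_linear: "bounded_linear L \<Longrightarrow> smooth_on S L"
  by (simp add: smooth_on_def Ck_on_bounded_linear)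

lemma smooth_on_add:
  "open S \<Longrightarrow> smooth_on S f \<Longrightarrow> smooth_on S g \<Longrightarrow> smooth_on S (\<lambda>x. f x + g x)"
  by (simp add: smooth_on_def Ck_on_add)

lemma smooth_on_scaleR:
  "open S \<Longrightarrow> smooth_on S f \<Longrightarrow> smooth_on S g \<Longrightarrow> smooth_on S (\<lambda>x. f x *\<^sub>R g x)"
  by (simp add: smooth_on_def Ck_on_scaleR)

text \<open>The correction \<open>h - \<Lambda> z0\<close> has zero derivative at \<open>z0\<close>,
  so \<open>G z0\<close> has the identity as its derivative there and is a local diffeomorphism. It
  moves points only along \<open>N\<close>, and \<open>\<Lambda> z0 N = 1\<close> gives
  \<open>\<Lambda> z0 (G z0 z) = h z\<close>: in the new coordinates \<open>h\<close> is
  linear.\<close>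

lemma straightening_diffeomorphism:
  fixes h :: "'e::euclidean_space \<Rightarrow> real" and N :: 'e
  defines "\<Lambda> \<equiv> \<lambda>z0. frechet_derivative h (at z0)"
  defines "G \<equiv> \<lambda>z0 z. z + (h z - \<Lambda> z0 z) *\<^sub>R N"
  assumes U: "open U" and h: "smooth_on U h" and z0: "z0 \<in> U" and N: "\<Lambda> z0 N = 1"
  obtains U' V J where "open U'" "z0 \<in> U'" "U' \<subseteq> U" "open V" "homeomorphism U' V (G z0) J"
    "smooth_on U' (G z0)" "smooth_on V J"
proof -
  \<comment> \<open>The derivative of \<open>G z0\<close> at \<open>z\<close> has determinant
    \<open>\<Lambda> z N\<close>, so \<open>W\<close> is the set where it is invertible.\<close>
  define W where "W = {z \<in> U. \<Lambda> z N \<noteq> 0}"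
  have \<Lambda>d: "(h has_derivative \<Lambda> z) (at z)" if "z \<in> U" for z
    unfolding \<Lambda>_def using smooth_on_has_derivative[OF h that] .
  have \<Lambda>s: "smooth_on U (\<lambda>z. \<Lambda> z v)" for v
    unfolding \<Lambda>_def by (rule smooth_on_frechet_derivative[OF h])
  have \<Lambda>l: "linear (\<Lambda> z)" if "z \<in> U" for z
    using has_derivative_linear[OF \<Lambda>d[OF that]] .
  have \<Lambda>0: "bounded_linear (\<Lambda> z0)"
    using \<Lambda>d[OF z0] by (rule has_derivative_bounded_linear)
  have "open (U \<inter> (\<lambda>z. \<Lambda> z N) -` (- {0}))"
    by (intro continuous_open_preimage smooth_on_continuous \<Lambda>s U) auto
  also have "U \<inter> (\<lambda>z. \<Lambda> z N) -` (- {0}) = W" by (auto simp: W_def)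
  finally have W: "open W" "W \<subseteq> U" "z0 \<in> W" using z0 N by (auto simp: W_def)
  define dG where "dG z v = v + (\<Lambda> z v - \<Lambda> z0 v) *\<^sub>R N" for z v
  have G: "(G z0 has_derivative dG z) (at z)" if "z \<in> U" for z
  proof -
    have "(\<Lambda> z0 has_derivative \<Lambda> z0) (at z)"
      using \<Lambda>0 by (rule bounded_linear_imp_has_derivative)
    then have "((\<lambda>z. z + (h z - \<Lambda> z0 z) *\<^sub>R N) has_derivative (\<lambda>v. v + (\<Lambda> z v - \<Lambda> z0 v) *\<^sub>R N)) (at z)"
      by (intro has_derivative_add has_derivative_ident has_derivative_scaleR_left has_derivative_diff \<Lambda>d[OF that])
    then show ?thesis by (simp add: G_def dG_def[abs_def])
  qed
  have dGs: "smooth_on U (\<lambda>z. dG z v)" for v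
  proof -
    have "smooth_on U (\<lambda>z. v + (\<Lambda> z v + - \<Lambda> z0 v) *\<^sub>R N)"
      by (intro smooth_on_add[OF U] smooth_on_scaleR[OF U] smooth_on_const \<Lambda>s)
    then show ?thesis by (simp add: dG_def)
  qed
  have dG_app: "blinfun_apply (Blinfun (dG z)) = dG z" if "z \<in> U" for z
    using has_derivative_bounded_linear[OF G[OF that]] by (rule bounded_linear_Blinfun_apply)
  have cont: "continuous_on W (\<lambda>z. Blinfun (dG z))"
  proof (rule continuous_on_blinfun_componentwise)
    fix i :: 'e
    show "continuous_on W (\<lambda>z. blinfun_apply (Blinfun (dG z)) i)"
      by (rule continuous_on_eq[OF continuous_on_subset[OF smooth_on_continuous[OF dGs] W(2)]])
        (use W in \<open>auto simp: dG_app\<close>)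
  qed
  have "blinfun_apply (Blinfun (dG z0)) v = v" for v
    by (simp add: dG_app[OF z0]) (simp add: dG_def)
  then have inv0: "id_blinfun o\<^sub>L Blinfun (dG z0) = id_blinfun"
    by (intro blinfun_eqI) simp
  have GW: "(G z0 has_derivative blinfun_apply (Blinfun (dG z))) (at z)" if "z \<in> W" for z
    using G dG_app W that by auto
  obtain U' V J J' where U': "open U'" "U' \<subseteq> W" "z0 \<in> U'" and V: "open V"
    and hom: "homeomorphism U' V (G z0) J"
    and J: "\<And>y. y \<in> V \<Longrightarrow> (J has_derivative (J' y)) (at y)"
    and J': "\<And>y. y \<in> V \<Longrightarrow> J' y = inv (blinfun_apply (Blinfun (dG (J y))))"
    and bij: "\<And>y. y \<in> V \<Longrightarrow> bij (blinfun_apply (Blinfun (dG (J y))))"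
    by (rule inverse_function_theorem[OF W(1) GW cont W(3) inv0]) blast+
  have JW: "J y \<in> W" if "y \<in> V" for y
    using hom U'(2) that by (auto simp: homeomorphism_def)
  \<comment> \<open>\<open>dG z\<close> is a rank-one perturbation of the identity, so its inverse is explicit (Sherman-Morrison);
    this formula makes the induction on the order of smoothness of \<open>J\<close> work.\<close>
  let ?K = "\<lambda>y v. v + (- ((\<Lambda> (J y) v + - \<Lambda> z0 v) * inverse (\<Lambda> (J y) N))) *\<^sub>R N"
  have J'_eq: "J' y = ?K y" if y: "y \<in> V" for y
  proof
    fix v
    have U: "J y \<in> U" and nz: "\<Lambda> (J y) N \<noteq> 0" using JW[OF y] by (auto simp: W_def)
    define c where "c = (\<Lambda> (J y) v - \<Lambda> z0 v) / \<Lambda> (J y) N"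
    have K: "?K y v = v - c *\<^sub>R N" by (simp add: c_def divide_inverse)
    have "\<Lambda> (J y) (v - c *\<^sub>R N) = \<Lambda> (J y) v - c * \<Lambda> (J y) N"
      by (simp add: linear_diff[OF \<Lambda>l[OF U]] linear_scale[OF \<Lambda>l[OF U]])
    also have "\<dots> = \<Lambda> z0 v" using nz by (simp add: c_def)
    finally have "dG (J y) (?K y v) = v"
      unfolding K by (simp add: dG_def linear_diff[OF \<Lambda>l[OF z0]] linear_scale[OF \<Lambda>l[OF z0]] N)
    then show "J' y v = ?K y v"
      using J'[OF y] bij[OF y] dG_app[OF U] by (simp add: inv_f_eq bij_is_inj)
  qed
  have "Ck_on k V J" for k
  proof (induction k)
    case 0
    then show ?case using hom by (simp add: homeomorphism_def)
  next
    case (Suc k)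
    have JU: "J ` V \<subseteq> U" using JW W(2) by auto
    have c: "Ck_on k V (\<lambda>y. \<Lambda> (J y) v)" for v
      by (rule Ck_on_compose[OF V U JU Suc.IH smooth_on_Ck[OF \<Lambda>s]])
    have i: "Ck_on k V (\<lambda>y. inverse (\<Lambda> (J y) N))"
      by (rule Ck_on_inverse[OF V c]) (use JW in \<open>auto simp: W_def\<close>)
    have s: "Ck_on k V (\<lambda>y. (\<Lambda> (J y) v + - \<Lambda> z0 v) *\<^sub>R inverse (\<Lambda> (J y) N))" for v
      by (rule Ck_on_scaleR[OF V Ck_on_add[OF V c Ck_on_const] i])
    have "Ck_on k V (\<lambda>y. v + (- ((\<Lambda> (J y) v + - \<Lambda> z0 v) *\<^sub>R inverse (\<Lambda> (J y) N))) *\<^sub>R N)" for v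
      by (rule Ck_on_add[OF V Ck_on_const Ck_on_scaleR[OF V
            Ck_on_linear_compose[OF V bounded_linear_minus[OF bounded_linear_ident] s] Ck_on_const]])
    then have "Ck_on k V (\<lambda>y. ?K y v)" for v by simp
    then show ?case using J J'_eq by (intro Ck_on_SucI[OF V, of J ?K]) auto
  qed
  then have "smooth_on V J" by (simp add: smooth_on_def)
  moreover have "smooth_on U' (G z0)"
    using U'(2) W(2) by (intro smooth_on_subset[OF smooth_on_has_derivativeI[OF U G dGs]]) auto
  ultimately show thesis
    using U' W(2) V hom by (intro that[of U' V J]) auto
qed

section \<open>Charts and coordinate vector fields\<close>

context
  fixes ch :: "('a::{t2_space,second_countable_topology}, 'e::euclidean_space) atlas"
  assumes M: "smooth_manifold ch"
begin

lemma is_chart_atlas: "is_chart (cdom ch p, cmap ch p)"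
  using M by (simp add: smooth_manifold_def cdom_def cmap_def)

lemma mem_cdom [simp]: "p \<in> cdom ch p"
  using M by (simp add: smooth_manifold_def)

lemma open_cdom: "open (cdom ch p)"
  using is_chart_atlas by (simp add: is_chart_def)

lemma chart_homeomorphism:
  "homeomorphism (cdom ch p) (cmap ch p ` cdom ch p) (cmap ch p) (cinv ch p)"
  using is_chart_atlas by (simp add: is_chart_def cinv_def)

lemma cinv_cmap [simp]: "q \<in> cdom ch p \<Longrightarrow> cinv ch p (cmap ch p q) = q"
  using chart_homeomorphism by (rule homeomorphism_apply1)

lemma cinv_mem: "x \<in> cmap ch p ` cdom ch p \<Longrightarrow> cinv ch p x \<in> cdom ch p"
  by auto

lemma open_cmap_image:
  assumes "open W" shows "open (cmap ch p ` (cdom ch p \<inter> W))"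
proof -
  have "open (cmap ch p ` cdom ch p)"
    using is_chart_atlas by (simp add: is_chart_def)
  then have "open (cmap ch p ` cdom ch p \<inter> cinv ch p -` W)"
    using homeomorphism_cont2[OF chart_homeomorphism] assms by (intro continuous_open_preimage)
  also have "cmap ch p ` cdom ch p \<inter> cinv ch p -` W = cmap ch p ` (cdom ch p \<inter> W)"
    by auto
  finally show ?thesis .
qed

lemma open_cmap_cdom: "open (cmap ch p ` cdom ch p)"
  using open_cmap_image[OF open_UNIV] by simp

lemma open_chart_preimage:
  assumes "open O'" shows "open (cdom ch p \<inter> cmap ch p -` O')"
  using homeomorphism_cont1[OF chart_homeomorphism] open_cdom assms
  by (intro continuous_open_preimage)

lemma transition_smooth:
  "smooth_on (cmap ch p ` (cdom ch p \<inter> cdom ch q)) (\<lambda>x. cmap ch q (cinv ch p x))"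
  using M by (simp add: smooth_manifold_def o_def)

lemma open_overlap: "open (cmap ch p ` (cdom ch p \<inter> cdom ch q))"
  by (rule open_cmap_image[OF open_cdom])

lemma transition_has_derivative:
  assumes "q \<in> cdom ch p" "q \<in> cdom ch r"
  shows "((\<lambda>x. cmap ch r (cinv ch p x)) has_derivative
    frechet_derivative (\<lambda>x. cmap ch r (cinv ch p x)) (at (cmap ch p q))) (at (cmap ch p q))"
  using smooth_on_has_derivative[OF transition_smooth] assms by blast

lemma dfun_cmap_has_derivative:
  assumes "q \<in> cdom ch r"
  shows "((\<lambda>x. cmap ch r (cinv ch q x)) has_derivative dfun ch (cmap ch r) q) (at (cmap ch q q))"
  using transition_has_derivative[of q q r] assms by (simp add: dfun_def[abs_def] o_def)

text \<open>The chain rule as a cocycle law for changes of chart; it is what allows vectors stored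
  in different charts to be compared.\<close>

lemma transition_derivative_comp:
  assumes "q \<in> cdom ch p" "q \<in> cdom ch r" "q \<in> cdom ch s"
  shows "frechet_derivative (\<lambda>x. cmap ch s (cinv ch r x)) (at (cmap ch r q))
      (frechet_derivative (\<lambda>x. cmap ch r (cinv ch p x)) (at (cmap ch p q)) v)
    = frechet_derivative (\<lambda>x. cmap ch s (cinv ch p x)) (at (cmap ch p q)) v"
proof -
  let ?D = "\<lambda>p r q. frechet_derivative (\<lambda>x. cmap ch r (cinv ch p x)) (at (cmap ch p q))"
  have "((\<lambda>x. cmap ch s (cinv ch r (cmap ch r (cinv ch p x)))) has_derivative
      (\<lambda>v. ?D r s q (?D p r q v))) (at (cmap ch p q))"
    using has_derivative_compose[OF transition_has_derivative[OF assms(1,2)], of _ "?D r s q"]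
      transition_has_derivative[OF assms(2,3)] assms(1) by simp
  then have "((\<lambda>x. cmap ch s (cinv ch p x)) has_derivative (\<lambda>v. ?D r s q (?D p r q v))) (at (cmap ch p q))"
    by (rule has_derivative_transform_within_open[OF _ open_overlap[of p r]]) (use assms in auto)
  from frechet_derivative_at[OF this] show ?thesis by metis
qed

lemma transition_derivative_self:
  assumes "q \<in> cdom ch p"
  shows "frechet_derivative (\<lambda>x. cmap ch p (cinv ch p x)) (at (cmap ch p q)) v = v"
proof -
  have "((\<lambda>x. cmap ch p (cinv ch p x)) has_derivative (\<lambda>v. v)) (at (cmap ch p q))"
    by (rule has_derivative_transform_within_open[OF has_derivative_ident open_cmap_cdom[of p]])
      (use assms in auto)
  from frechet_derivative_at[OF this] show ?thesis by metis
qed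

text \<open>The vector field on \<open>cdom ch p\<close> whose components in the chart \<open>ch p\<close> are constantly \<open>v\<close>.\<close>

definition coord_field :: "'a \<Rightarrow> 'e \<Rightarrow> 'a \<Rightarrow> 'e" where
  "coord_field p v q = frechet_derivative (\<lambda>x. cmap ch q (cinv ch p x)) (at (cmap ch p q)) v"

lemma linear_coord_field: "q \<in> cdom ch p \<Longrightarrow> linear (\<lambda>v. coord_field p v q)"
  unfolding coord_field_def[abs_def]
  by (rule has_derivative_linear[OF transition_has_derivative]) auto

lemma dfun_cmap_coord_field:
  assumes "q \<in> cdom ch p" "q \<in> cdom ch r"
  shows "dfun ch (cmap ch r) q (coord_field p v q)
    = frechet_derivative (\<lambda>x. cmap ch r (cinv ch p x)) (at (cmap ch p q)) v"
  unfolding coord_field_def dfun_def o_def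
  by (rule transition_derivative_comp) (use assms in auto)

lemma coord_field_dfun_cmap:
  assumes "q \<in> cdom ch p"
  shows "coord_field p (dfun ch (cmap ch p) q v) q = v"
  unfolding coord_field_def dfun_def o_def
  using transition_derivative_comp[of q q p q v] transition_derivative_self[of q q v] assms by simp

lemma vf_rep_coord_field:
  assumes "x \<in> cmap ch r ` (cdom ch r \<inter> cdom ch p)"
  shows "vf_rep ch r (coord_field p v) x
    = frechet_derivative (\<lambda>x. cmap ch r (cinv ch p x)) (at (cmap ch p (cinv ch r x))) v"
  unfolding vf_rep_def Let_def by (rule dfun_cmap_coord_field) (use assms in auto)

lemma smooth_coord_field: "smooth_vf_on ch (cdom ch p) (coord_field p v)"
  unfolding smooth_vf_on_def
proof
  fix r
  let ?E = "\<lambda>x. frechet_derivative (\<lambda>x. cmap ch r (cinv ch p x)) (at x) v"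
  have "smooth_on (cmap ch r ` (cdom ch r \<inter> cdom ch p)) (\<lambda>x. ?E (cmap ch p (cinv ch r x)))"
    by (rule smooth_on_compose[OF open_overlap open_overlap[of p r] _ transition_smooth
          smooth_on_frechet_derivative[OF transition_smooth]]) auto
  then show "smooth_on (cmap ch r ` (cdom ch r \<inter> cdom ch p)) (vf_rep ch r (coord_field p v))"
    by (rule smooth_on_cong[OF open_overlap, rotated]) (simp add: vf_rep_coord_field)
qed

text \<open>\<open>F\<close> and \<open>B\<close> express one function in the charts at
  \<open>q\<close> and at \<open>p\<close>. A derivative along a coordinate field, formally computed
  in a chart that changes with \<open>q\<close>, becomes a directional derivative in the fixed chart
  \<open>ch p\<close>. The general codomain covers both functions and components of fields.\<close>

lemma dfun_along_coord_field:
  fixes B :: "'e \<Rightarrow> 'c::real_normed_vector"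
  assumes q: "q \<in> cdom ch p" and B: "smooth_on (cmap ch p ` (cdom ch p \<inter> cdom ch q)) B"
    and F: "\<And>x. x \<in> cmap ch q ` (cdom ch q \<inter> cdom ch p) \<Longrightarrow> F x = B (cmap ch p (cinv ch q x))"
  shows "frechet_derivative F (at (cmap ch q q)) (coord_field p u q)
    = frechet_derivative B (at (cmap ch p q)) u"
proof -
  have "(B has_derivative frechet_derivative B (at (cmap ch p q))) (at (cmap ch p (cinv ch q (cmap ch q q))))"
    using smooth_on_has_derivative[OF B, of "cmap ch p q"] q by simp
  from has_derivative_compose[OF dfun_cmap_has_derivative[OF q] this]
  have "((\<lambda>x. B (cmap ch p (cinv ch q x))) has_derivative
      (\<lambda>v. frechet_derivative B (at (cmap ch p q)) (dfun ch (cmap ch p) q v))) (at (cmap ch q q))" .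
  then have "(F has_derivative
      (\<lambda>v. frechet_derivative B (at (cmap ch p q)) (dfun ch (cmap ch p) q v))) (at (cmap ch q q))"
    by (rule has_derivative_transform_within_open[OF _ open_overlap[of q p]]) (use q F in auto)
  from frechet_derivative_at[OF this]
  have "frechet_derivative F (at (cmap ch q q)) (coord_field p u q)
    = frechet_derivative B (at (cmap ch p q)) (dfun ch (cmap ch p) q (coord_field p u q))"
    by metis
  then show ?thesis
    using dfun_cmap_coord_field[OF q q] transition_derivative_self[OF q] by simp
qed

text \<open>Read at \<open>q\<close>, the components of a coordinate field are first derivatives of
  a transition map, so the bracket is a difference of second derivatives taken in opposite
  orders.\<close>

lemma lie_bracket_coord_field:
  assumes q: "q \<in> cdom ch p"
  shows "lie_bracket ch (coord_field p u) (coord_field p v) q = 0"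
proof -
  let ?\<sigma> = "\<lambda>x. cmap ch q (cinv ch p x)"
  let ?S = "cmap ch p ` (cdom ch p \<inter> cdom ch q)"
  have "frechet_derivative (vf_rep ch q (coord_field p v)) (at (cmap ch q q)) (coord_field p u q)
    = frechet_derivative (\<lambda>x. frechet_derivative ?\<sigma> (at x) v) (at (cmap ch p q)) u" for u v
    by (rule dfun_along_coord_field[OF q smooth_on_frechet_derivative[OF transition_smooth]])
      (rule vf_rep_coord_field)
  moreover have "frechet_derivative (\<lambda>x. frechet_derivative ?\<sigma> (at x) v) (at (cmap ch p q)) u
    = frechet_derivative (\<lambda>x. frechet_derivative ?\<sigma> (at x) u) (at (cmap ch p q)) v"
    by (rule frechet_derivative_commute[OF open_overlap _ smooth_on_Ck[OF transition_smooth]])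
      (use q in auto)
  ultimately show ?thesis by (simp add: lie_bracket_def)
qed

text \<open>For commuting fields \<open>X\<close>, \<open>Y\<close> a parallel form satisfies
  \<open>X(\<eta> Y) - Y(\<eta> X) = \<eta>(nab_X Y - nab_Y X) = \<eta>[X,Y] = 0\<close>. Coordinate
  fields commute, and a ball in the chart provides the convex domain for the Poincare lemma.\<close>

lemma parallel_form_has_local_primitive:
  fixes \<eta> :: "'a \<Rightarrow> 'e \<Rightarrow> real"
  assumes lc: "levi_civita ch g nab" and par: "parallel_form ch nab \<eta>"
    and lin: "\<And>p. linear (\<eta> p)"
    and sm: "\<forall>W X. open W \<and> smooth_vf_on ch W X \<longrightarrow> smooth_fun_on ch W (\<lambda>q. \<eta> q (X q))"
  obtains B K where "open B" "cmap ch p p \<in> B" "B \<subseteq> cmap ch p ` cdom ch p" "smooth_on B K"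
    "\<And>q. q \<in> cdom ch p \<Longrightarrow> cmap ch p q \<in> B \<Longrightarrow>
      (K has_derivative (\<lambda>v. \<eta> q (coord_field p v q))) (at (cmap ch p q))"
proof -
  obtain e where e: "e > 0" "ball (cmap ch p p) e \<subseteq> cmap ch p ` cdom ch p"
    using open_cmap_cdom[of p] by (meson image_eqI mem_cdom open_contains_ball)
  let ?B = "ball (cmap ch p p) e"
  \<comment> \<open>The components of \<eta> in the chart \<open>ch p\<close>, as a 1-form on an
    open set of the model space.\<close>
  define A where "A x v = \<eta> (cinv ch p x) (coord_field p v (cinv ch p x))" for x v
  have smA: "smooth_on (cmap ch p ` cdom ch p) (\<lambda>x. A x v)" for v
    using sm[rule_format, OF conjI[OF open_cdom smooth_coord_field[of p v]]]
    by (simp add: smooth_fun_on_def o_def A_def) (metis Int_absorb)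
  have linA: "linear (A x)" if "x \<in> ?B" for x
    using linear_compose[OF linear_coord_field lin] cinv_mem that e
    by (simp add: A_def[abs_def] o_def subset_eq)
  have dA: "dfun ch (\<lambda>q. \<eta> q (coord_field p v q)) q (coord_field p u q)
      = frechet_derivative (\<lambda>x. A x v) (at (cmap ch p q)) u" if q: "q \<in> cdom ch p" for q u v
    unfolding dfun_def
    by (rule dfun_along_coord_field[OF q smooth_on_subset[OF smA]]) (auto simp: A_def)
  have closed: "frechet_derivative (\<lambda>x. A x u) (at x) v = frechet_derivative (\<lambda>x. A x v) (at x) u"
    if x: "x \<in> ?B" for x u v
  proof -
    obtain q where q: "q \<in> cdom ch p" "x = cmap ch p q" using x e by auto
    have nab: "dfun ch (\<lambda>q. \<eta> q (coord_field p u q)) q w = \<eta> q (nab q w (coord_field p u))" for u w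
      using par q(1) open_cdom smooth_coord_field unfolding parallel_form_def by fastforce
    have "\<eta> q (nab q (coord_field p u q) (coord_field p v)) -
        \<eta> q (nab q (coord_field p v q) (coord_field p u)) =
        \<eta> q (lie_bracket ch (coord_field p u) (coord_field p v) q)"
      using lc q(1) open_cdom[of p] smooth_coord_field[of p]
      unfolding levi_civita_def linear_diff[OF lin, symmetric] by (intro arg_cong[of _ _ "\<eta> q"]) blast
    also have "\<dots> = 0"
      by (simp add: lie_bracket_coord_field[OF q(1)] linear_0[OF lin])
    finally show ?thesis by (simp add: q(2) flip: dA[OF q(1)] nab)
  qed
  obtain K where K: "\<And>x. x \<in> ?B \<Longrightarrow> (K has_derivative A x) (at x)" "smooth_on ?B K"
    using closed_one_form_has_primitive[of ?B "cmap ch p p" A, OF open_ball convex_ball _ linA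
        smooth_on_subset[OF smA e(2)] closed] e(1) by auto
  show thesis
  proof (rule that[OF open_ball _ e(2) K(2)])
    fix q assume "q \<in> cdom ch p" "cmap ch p q \<in> ?B"
    then show "(K has_derivative (\<lambda>v. \<eta> q (coord_field p v q))) (at (cmap ch p q))"
      using K(1)[of "cmap ch p q"] by (simp add: A_def[abs_def])
  qed (use e in auto)
qed

section \<open>New charts of the maximal atlas from diffeomorphisms of coordinates\<close>

lemma compatible_chart_compose:
  assumes U: "open U" "U \<subseteq> cmap ch p ` cdom ch p" and V: "open V"
    and hom: "homeomorphism U V G J" and G: "smooth_on U G" and J: "smooth_on V J"
  shows "compatible_chart ch (cdom ch p \<inter> cmap ch p -` U, G \<circ> cmap ch p)"
proof -
  let ?W = "cdom ch p \<inter> cmap ch p -` U"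
  have img: "cmap ch p ` ?W = U" using U(2) by auto
  then have imgV: "(G \<circ> cmap ch p) ` ?W = V"
    using homeomorphism_image1[OF hom] by (simp only: image_comp[symmetric])
  have "homeomorphism ?W U (cmap ch p) (cinv ch p)"
    using homeomorphism_of_subsets[OF chart_homeomorphism, of ?W p U] U img by auto
  then have hW: "homeomorphism ?W V (G \<circ> cmap ch p) (cinv ch p \<circ> J)"
    using hom by (rule homeomorphism_compose)
  \<comment> \<open>The definition of a chart speaks of \<open>inv_into\<close>, which is determined
    only on the image; there it is the expected composite.\<close>
  then have inv: "inv_into ?W (G \<circ> cmap ch p) y = cinv ch p (J y)" if "y \<in> V" for y
    by (smt (verit, best) comp_apply f_inv_into_f homeomorphism_def image_eqI imgV inv_into_into that)
  have "homeomorphism ?W V (G \<circ> cmap ch p) (inv_into ?W (G \<circ> cmap ch p))"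
    by (rule homeomorphism_cong[OF hW]) (use inv in auto)
  then have "is_chart (?W, G \<circ> cmap ch p)"
    unfolding is_chart_def using imgV V open_chart_preimage[OF U(1)] by simp
  moreover have "smooth_on (cmap ch q ` (cdom ch q \<inter> ?W)) (G \<circ> cmap ch p \<circ> cinv ch q)" for q
    unfolding o_def
    by (rule smooth_on_compose[OF open_cmap_image[OF open_chart_preimage[OF U(1)]] U(1) _
          smooth_on_subset[OF transition_smooth] G]) auto
  moreover have "smooth_on ((G \<circ> cmap ch p) ` (cdom ch q \<inter> ?W)) (cmap ch q \<circ> inv_into ?W (G \<circ> cmap ch p))" for q
  proof -
    let ?T = "cmap ch p ` (cdom ch p \<inter> cdom ch q)"
    \<comment> \<open>Written as a preimage under the continuous map \<open>J\<close>, the overlap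
      is visibly open.\<close>
    have eq: "(G \<circ> cmap ch p) ` (cdom ch q \<inter> ?W) = V \<inter> J -` (?T \<inter> U)"
    proof (intro set_eqI iffI)
      fix y assume "y \<in> (G \<circ> cmap ch p) ` (cdom ch q \<inter> ?W)"
      then obtain x where "x \<in> cdom ch p" "x \<in> cdom ch q" "cmap ch p x \<in> U" "y = G (cmap ch p x)"
        by auto
      then show "y \<in> V \<inter> J -` (?T \<inter> U)"
        using hom by (auto simp: homeomorphism_def)
    next
      fix y assume "y \<in> V \<inter> J -` (?T \<inter> U)"
      then obtain z where "y \<in> V" "J y \<in> U" "J y = cmap ch p z" "z \<in> cdom ch p" "z \<in> cdom ch q"
        by auto
      then show "y \<in> (G \<circ> cmap ch p) ` (cdom ch q \<inter> ?W)"
        using homeomorphism_apply2[OF hom, of y] by (intro image_eqI[of _ _ z]) auto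
    qed
    have op: "open ((G \<circ> cmap ch p) ` (cdom ch q \<inter> ?W))"
      unfolding eq using homeomorphism_cont2[OF hom] V open_overlap U(1)
      by (intro continuous_open_preimage open_Int)
    have "smooth_on ((G \<circ> cmap ch p) ` (cdom ch q \<inter> ?W)) (\<lambda>y. cmap ch q (cinv ch p (J y)))"
      by (rule smooth_on_compose[OF op open_overlap _ smooth_on_subset[OF J] transition_smooth])
        (use eq in auto)
    then show ?thesis
      by (rule smooth_on_cong[OF op, rotated]) (use eq inv in auto)
  qed
  ultimately show ?thesis by (simp add: compatible_chart_def)
qed

end

section \<open>Primitives along smooth maps and product manifolds\<close>

lemma smooth_map_has_derivative:
  assumes F: "smooth_map chM ch F" and "p \<in> cdom chM r" "F p \<in> cdom ch q"
  shows "((\<lambda>x. cmap ch q (F (cinv chM r x))) has_derivative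
    frechet_derivative (\<lambda>x. cmap ch q (F (cinv chM r x))) (at (cmap chM r p))) (at (cmap chM r p))"
  by (rule smooth_on_has_derivative[of "cmap chM r ` (cdom chM r \<inter> F -` cdom ch q)"])
    (use assms in \<open>auto simp: smooth_map_def o_def\<close>)

lemma differential_has_derivative:
  assumes M: "smooth_manifold chM" and N: "smooth_manifold ch" and F: "smooth_map chM ch F"
  shows "((\<lambda>x. cmap ch (F p) (F (cinv chM p x))) has_derivative differential chM ch F p) (at (cmap chM p p))"
  using smooth_map_has_derivative[OF F, of p p "F p"] mem_cdom[OF M] mem_cdom[OF N]
  by (simp add: differential_def dfun_def[abs_def] o_def)

lemma open_smooth_map_vimage:
  "smooth_map chM ch F \<Longrightarrow> open W \<Longrightarrow> open (F -` W)"
  by (simp add: smooth_map_def continuous_on_open_vimage)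

text \<open>A primitive \<open>K\<close> of \<eta> near \<open>F p\<close>, composed with the
  coordinate expression of \<open>F\<close>, is a primitive of the pulled back form by the chain
  rule. The conclusion holds at all nearby \<open>p'\<close>, whose tangent vectors are first
  carried into the chart at \<open>p\<close>.\<close>

lemma parallel_form_pullback_primitive:
  fixes chM :: "('b::{t2_space,second_countable_topology}, 'f::euclidean_space) atlas"
    and ch :: "('a::{t2_space,second_countable_topology}, 'e::euclidean_space) atlas"
    and \<eta> :: "'a \<Rightarrow> 'e \<Rightarrow> real"
  assumes M: "smooth_manifold chM" and N: "smooth_manifold ch" and F: "smooth_map chM ch F"
    and lc: "levi_civita ch g nab" and par: "parallel_form ch nab \<eta>"
    and lin: "\<And>p. linear (\<eta> p)"
    and sm: "\<forall>W X. open W \<and> smooth_vf_on ch W X \<longrightarrow> smooth_fun_on ch W (\<lambda>q. \<eta> q (X q))"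
  obtains U h where "open U" "cmap chM p p \<in> U" "U \<subseteq> cmap chM p ` cdom chM p" "smooth_on U h"
    "\<forall>p'\<in>cdom chM p. \<forall>v. cmap chM p p' \<in> U \<longrightarrow>
      frechet_derivative h (at (cmap chM p p')) (dfun chM (cmap chM p) p' v)
        = \<eta> (F p') (differential chM ch F p' v)"
proof -
  note [simp] = mem_cdom[OF M] mem_cdom[OF N] cinv_cmap[OF M] cinv_cmap[OF N]
  obtain B K where B: "open B" "cmap ch (F p) (F p) \<in> B" "B \<subseteq> cmap ch (F p) ` cdom ch (F p)"
      "smooth_on B K"
    and K: "\<And>q. q \<in> cdom ch (F p) \<Longrightarrow> cmap ch (F p) q \<in> B \<Longrightarrow>
      (K has_derivative (\<lambda>v. \<eta> q (coord_field ch (F p) v q))) (at (cmap ch (F p) q))"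
    by (rule parallel_form_has_local_primitive[OF N lc par lin sm, of "F p"]) (rule that, blast+)
  define \<rho> where "\<rho> x = cmap ch (F p) (F (cinv chM p x))" for x
  define T where "T = cmap chM p ` (cdom chM p \<inter> F -` cdom ch (F p))"
  define U where "U = T \<inter> \<rho> -` B"
  have T: "open T"
    unfolding T_def by (rule open_cmap_image[OF M open_smooth_map_vimage[OF F open_cdom[OF N]]])
  have \<rho>: "smooth_on T \<rho>"
    using F by (simp add: smooth_map_def T_def \<rho>_def[abs_def] o_def)
  have U: "open U"
    unfolding U_def by (rule continuous_open_preimage[OF smooth_on_continuous[OF \<rho>] T B(1)])
  have h: "smooth_on U (\<lambda>x. K (\<rho> x))"
    by (rule smooth_on_compose[OF U B(1) _ smooth_on_subset[OF \<rho>] B(4)]) (auto simp: U_def)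
  show thesis
  proof (rule that[OF U _ _ h], safe)
    show "cmap chM p p \<in> U" using B(2) by (auto simp: U_def T_def \<rho>_def)
    show "x \<in> cmap chM p ` cdom chM p" if "x \<in> U" for x using that by (auto simp: U_def T_def)
    fix p' v assume p': "p' \<in> cdom chM p" and x: "cmap chM p p' \<in> U"
    let ?q = "F p'"
    have q: "?q \<in> cdom ch (F p)" "cmap ch (F p) ?q \<in> B"
    proof -
      obtain z where z: "z \<in> cdom chM p" "F z \<in> cdom ch (F p)" "cmap chM p p' = cmap chM p z"
        using x by (auto simp: U_def T_def)
      then have "p' = z" using cinv_cmap[OF M] p' by metis
      then show "?q \<in> cdom ch (F p)" "cmap ch (F p) ?q \<in> B"
        using z x p' by (auto simp: U_def \<rho>_def)
    qed
    \<comment> \<open>Near \<open>p'\<close> the same function factors as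
      \<open>K \<circ> \<rho> \<circ> ?\<tau>\<close> through the chart at \<open>p\<close> and as
      \<open>K \<circ> ?\<kappa> \<circ> ?\<sigma>\<close> through the charts at \<open>p'\<close>
      and \<open>F p'\<close>. Uniqueness of the derivative equates the two chain rules.\<close>
    let ?\<tau> = "\<lambda>x. cmap chM p (cinv chM p' x)"
    let ?\<sigma> = "\<lambda>x. cmap ch ?q (F (cinv chM p' x))"
    let ?\<kappa> = "\<lambda>x. cmap ch (F p) (cinv ch ?q x)"
    let ?x = "cmap chM p' p'"
    have "((\<lambda>x. K (\<rho> x)) has_derivative frechet_derivative (\<lambda>x. K (\<rho> x)) (at (cmap chM p p'))) (at (?\<tau> ?x))"
      using smooth_on_has_derivative[OF h x] by simp
    from has_derivative_compose[OF dfun_cmap_has_derivative[OF M p'] this]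
    have 1: "((\<lambda>x. K (\<rho> (?\<tau> x))) has_derivative
        (\<lambda>v. frechet_derivative (\<lambda>x. K (\<rho> x)) (at (cmap chM p p')) (dfun chM (cmap chM p) p' v))) (at ?x)" .
    have "(K has_derivative (\<lambda>v. \<eta> ?q (coord_field ch (F p) v ?q))) (at (?\<kappa> (cmap ch ?q ?q)))"
      using K[OF q] by simp
    from has_derivative_compose[OF dfun_cmap_has_derivative[OF N q(1)] this]
    have "((\<lambda>x. K (?\<kappa> x)) has_derivative (\<lambda>v. \<eta> ?q v)) (at (?\<sigma> ?x))"
      by (simp add: coord_field_dfun_cmap[OF N q(1)])
    from has_derivative_compose[OF differential_has_derivative[OF M N F] this]
    have "((\<lambda>x. K (?\<kappa> (?\<sigma> x))) has_derivative (\<lambda>v. \<eta> ?q (differential chM ch F p' v))) (at ?x)" .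
    then have 2: "((\<lambda>x. K (\<rho> (?\<tau> x))) has_derivative (\<lambda>v. \<eta> ?q (differential chM ch F p' v))) (at ?x)"
    proof (rule has_derivative_transform_within_open)
      let ?S = "cdom chM p' \<inter> (cdom chM p \<inter> F -` cdom ch ?q)"
      show "open (cmap chM p' ` ?S)"
        by (intro open_cmap_image[OF M] open_Int open_smooth_map_vimage[OF F] open_cdom[OF N] open_cdom[OF M])
      show "?x \<in> cmap chM p' ` ?S" using p' by simp
      show "K (?\<kappa> (?\<sigma> x)) = K (\<rho> (?\<tau> x))" if "x \<in> cmap chM p' ` ?S" for x
        using that by (auto simp: \<rho>_def)
    qed
    show "frechet_derivative (\<lambda>x. K (\<rho> x)) (at (cmap chM p p')) (dfun chM (cmap chM p) p' v)
        = \<eta> (F p') (differential chM ch F p' v)"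
      by (rule has_derivative_unique[OF 1 2, THEN fun_cong])
  qed
qed

section \<open>Product charts and slices\<close>

lemma cdom_prod_atlas: "cdom (prod_atlas ch ch') p = cdom ch (fst p) \<times> cdom ch' (snd p)"
  by (simp add: cdom_def prod_atlas_def split: prod.split)

lemma cmap_prod_atlas: "cmap (prod_atlas ch ch') p q = (cmap ch (fst p) (fst q), cmap ch' (snd p) (snd q))"
  by (simp add: cmap_def prod_atlas_def map_prod_def split: prod.split)

lemma dfun_cmap_self: "smooth_manifold ch \<Longrightarrow> dfun ch (cmap ch p) p v = v"
  unfolding dfun_def o_def by (rule transition_derivative_self[OF _ mem_cdom])

lemma image_slice_eq:
  fixes f :: "'i \<Rightarrow> 'k::ab_group_add"
  shows "(\<And>q. q \<in> W \<Longrightarrow> q \<in> S \<longleftrightarrow> f q - c \<in> V) \<Longrightarrow> f ` (W \<inter> S) = {x \<in> f ` W. x - c \<in> V}"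
  by blast

context
  fixes chF :: "('b::{t2_space,second_countable_topology}, 'f::euclidean_space) atlas"
    and chB :: "('c::{t2_space,second_countable_topology}, 'h::euclidean_space) atlas"
  assumes mF: "smooth_manifold chF" and mB: "smooth_manifold chB"
    and mP: "smooth_manifold (prod_atlas chF chB)"
begin

lemma cinv_prod_atlas:
  assumes "a \<in> cmap chF (fst p) ` cdom chF (fst p)" "b \<in> cmap chB (snd p) ` cdom chB (snd p)"
  shows "cinv (prod_atlas chF chB) p (a, b) = (cinv chF (fst p) a, cinv chB (snd p) b)"
proof -
  obtain q r where "q \<in> cdom chF (fst p)" "a = cmap chF (fst p) q"
    "r \<in> cdom chB (snd p)" "b = cmap chB (snd p) r" using assms by auto
  then show ?thesis
    using cinv_cmap[OF mP, of "(q, r)" p] cinv_cmap[OF mF] cinv_cmap[OF mB]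
    by (simp add: cdom_prod_atlas cmap_prod_atlas)
qed

lemma dfun_cmap_prod_atlas:
  assumes "q \<in> cdom (prod_atlas chF chB) p"
  shows "dfun (prod_atlas chF chB) (cmap (prod_atlas chF chB) p) q v =
    (dfun chF (cmap chF (fst p)) (fst q) (fst v), dfun chB (cmap chB (snd p)) (snd q) (snd v))"
proof -
  let ?x = "cmap (prod_atlas chF chB) q q"
  have q: "fst q \<in> cdom chF (fst p)" "snd q \<in> cdom chB (snd p)"
    using assms by (auto simp: cdom_prod_atlas)
  have "((\<lambda>x. cmap chF (fst p) (cinv chF (fst q) (fst x))) has_derivative
      (\<lambda>v. dfun chF (cmap chF (fst p)) (fst q) (fst v))) (at ?x)"
    using dfun_cmap_has_derivative[OF mF q(1)]
    by (intro has_derivative_compose[OF has_derivative_fst[OF has_derivative_ident]])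
      (simp add: cmap_prod_atlas)
  moreover have "((\<lambda>x. cmap chB (snd p) (cinv chB (snd q) (snd x))) has_derivative
      (\<lambda>v. dfun chB (cmap chB (snd p)) (snd q) (snd v))) (at ?x)"
    using dfun_cmap_has_derivative[OF mB q(2)]
    by (intro has_derivative_compose[OF has_derivative_snd[OF has_derivative_ident]])
      (simp add: cmap_prod_atlas)
  ultimately have "((\<lambda>x. (cmap chF (fst p) (cinv chF (fst q) (fst x)), cmap chB (snd p) (cinv chB (snd q) (snd x))))
      has_derivative (\<lambda>v. (dfun chF (cmap chF (fst p)) (fst q) (fst v),
        dfun chB (cmap chB (snd p)) (snd q) (snd v)))) (at ?x)"
    by (rule has_derivative_Pair)
  then have "((\<lambda>x. cmap (prod_atlas chF chB) p (cinv (prod_atlas chF chB) q x))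
      has_derivative (\<lambda>v. (dfun chF (cmap chF (fst p)) (fst q) (fst v),
        dfun chB (cmap chB (snd p)) (snd q) (snd v)))) (at ?x)"
  proof (rule has_derivative_transform_within_open[OF _ open_cmap_cdom[OF mP, of q]])
    show "?x \<in> cmap (prod_atlas chF chB) q ` cdom (prod_atlas chF chB) q"
      using mem_cdom[OF mP, of q] by (rule imageI)
    fix x assume "x \<in> cmap (prod_atlas chF chB) q ` cdom (prod_atlas chF chB) q"
    then obtain r where r: "r \<in> cdom (prod_atlas chF chB) q" "x = cmap (prod_atlas chF chB) q r" ..
    show "(cmap chF (fst p) (cinv chF (fst q) (fst x)), cmap chB (snd p) (cinv chB (snd q) (snd x)))
        = cmap (prod_atlas chF chB) p (cinv (prod_atlas chF chB) q x)"
      unfolding r(2) cinv_cmap[OF mP r(1)] using r(1)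
      by (simp add: cmap_prod_atlas cdom_prod_atlas mem_Times_iff cinv_cmap[OF mF] cinv_cmap[OF mB])
  qed
  from has_derivative_unique[OF this dfun_cmap_has_derivative[OF mP assms], THEN fun_cong, of v]
  show ?thesis by (rule sym)
qed

text \<open>Invariance and anti-invariance are assumed for the leaves, which are immersed
  separately; this and its twin express them through the one differential of \<open>F\<close> at
  \<open>(x, y)\<close>.\<close>

lemma differential_slice1:
  assumes N: "smooth_manifold ch" and F: "smooth_map (prod_atlas chF chB) ch F"
  shows "differential chF ch (\<lambda>x. F (x, y)) x u = differential (prod_atlas chF chB) ch F (x, y) (u, 0)"
proof -
  let ?P = "prod_atlas chF chB"
  let ?b = "cmap chB y y"
  have "((\<lambda>a. (a, ?b)) has_derivative (\<lambda>u. (u, 0))) (at (cmap chF x x))"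
    by (intro has_derivative_Pair has_derivative_ident has_derivative_const)
  moreover have "((\<lambda>z. cmap ch (F (x, y)) (F (cinv ?P (x, y) z))) has_derivative differential ?P ch F (x, y))
      (at (cmap chF x x, ?b))"
    using differential_has_derivative[OF mP N F, of "(x, y)"] by (simp add: cmap_prod_atlas)
  ultimately have "((\<lambda>a. cmap ch (F (x, y)) (F (cinv ?P (x, y) (a, ?b)))) has_derivative
      (\<lambda>u. differential ?P ch F (x, y) (u, 0))) (at (cmap chF x x))"
    by (rule has_derivative_compose)
  then have "((\<lambda>a. cmap ch (F (x, y)) (F (cinv chF x a, y))) has_derivative
      (\<lambda>u. differential ?P ch F (x, y) (u, 0))) (at (cmap chF x x))"
  proof (rule has_derivative_transform_within_open[OF _ open_cmap_cdom[OF mF, of x]])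
    show "cmap chF x x \<in> cmap chF x ` cdom chF x" by (rule imageI[OF mem_cdom[OF mF]])
    show "cmap ch (F (x, y)) (F (cinv ?P (x, y) (a, ?b))) = cmap ch (F (x, y)) (F (cinv chF x a, y))"
      if "a \<in> cmap chF x ` cdom chF x" for a
      using cinv_prod_atlas[of a "(x, y)" ?b] that mem_cdom[OF mB, of y] cinv_cmap[OF mB, of y y] by simp
  qed
  from frechet_derivative_at[OF this, THEN fun_cong, of u] show ?thesis
    unfolding differential_def[of chF] dfun_def o_def by (rule sym)
qed

lemma differential_slice2:
  assumes N: "smooth_manifold ch" and F: "smooth_map (prod_atlas chF chB) ch F"
  shows "differential chB ch (\<lambda>y. F (x, y)) y w = differential (prod_atlas chF chB) ch F (x, y) (0, w)"
proof -
  let ?P = "prod_atlas chF chB"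
  let ?a = "cmap chF x x"
  have "((\<lambda>b. (?a, b)) has_derivative (\<lambda>w. (0, w))) (at (cmap chB y y))"
    by (intro has_derivative_Pair has_derivative_ident has_derivative_const)
  moreover have "((\<lambda>z. cmap ch (F (x, y)) (F (cinv ?P (x, y) z))) has_derivative differential ?P ch F (x, y))
      (at (?a, cmap chB y y))"
    using differential_has_derivative[OF mP N F, of "(x, y)"] by (simp add: cmap_prod_atlas)
  ultimately have "((\<lambda>b. cmap ch (F (x, y)) (F (cinv ?P (x, y) (?a, b)))) has_derivative
      (\<lambda>w. differential ?P ch F (x, y) (0, w))) (at (cmap chB y y))"
    by (rule has_derivative_compose)
  then have "((\<lambda>b. cmap ch (F (x, y)) (F (x, cinv chB y b))) has_derivative
      (\<lambda>w. differential ?P ch F (x, y) (0, w))) (at (cmap chB y y))"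
  proof (rule has_derivative_transform_within_open[OF _ open_cmap_cdom[OF mB, of y]])
    show "cmap chB y y \<in> cmap chB y ` cdom chB y" by (rule imageI[OF mem_cdom[OF mB]])
    show "cmap ch (F (x, y)) (F (cinv ?P (x, y) (?a, b))) = cmap ch (F (x, y)) (F (x, cinv chB y b))"
      if "b \<in> cmap chB y ` cdom chB y" for b
      using cinv_prod_atlas[of ?a "(x, y)" b] that mem_cdom[OF mF, of x] cinv_cmap[OF mF, of x x] by simp
  qed
  from frechet_derivative_at[OF this, THEN fun_cong, of w] show ?thesis
    unfolding differential_def[of chB] dfun_def o_def by (rule sym)
qed

section \<open>Leaves in a product\<close>

lemma integrable_second_factor:
  "integrable_distribution (prod_atlas chF chB) (\<lambda>_. {v. fst v = 0})"
  unfolding integrable_distribution_def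
proof
  fix p0
  let ?P = "prod_atlas chF chB"
  \<comment> \<open>On this slice the first coordinate is constantly \<open>fst p0\<close>, so the
    first block of the change of chart from a point of the slice to \<open>p0\<close> is the
    identity and the tangent condition needs no transport.\<close>
  let ?S = "{q \<in> cdom ?P p0. fst q = fst p0}"
  let ?U = "cmap ?P p0 ` cdom ?P p0"
  \<comment> \<open>Straightening by the identity: the chart at \<open>p0\<close> itself belongs to
    the maximal atlas.\<close>
  have "compatible_chart ?P (cdom ?P p0 \<inter> cmap ?P p0 -` ?U, (\<lambda>x. x) \<circ> cmap ?P p0)"
    using open_cmap_cdom[OF mP, of p0] smooth_on_bounded_linear[OF bounded_linear_ident]
    by (intro compatible_chart_compose[OF mP, where J = "\<lambda>x. x" and V = ?U])
      (auto simp: homeomorphism_ident)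
  moreover have "cdom ?P p0 \<inter> cmap ?P p0 -` ?U = cdom ?P p0" by auto
  ultimately have chart: "compatible_chart ?P (cdom ?P p0, cmap ?P p0)" by (simp add: o_def)
  have inj: "a = b" if "cmap chF (fst p0) a = cmap chF (fst p0) b" "a \<in> cdom chF (fst p0)"
    "b \<in> cdom chF (fst p0)" for a b
    using that by (metis cinv_cmap[OF mF])
  have "integral_manifold ?P (\<lambda>_. {v. fst v = 0}) ?S"
    unfolding integral_manifold_def
  proof
    fix p assume p: "p \<in> ?S"
    let ?V = "{v :: 'f \<times> 'h. fst v = 0}"
    have pU: "p \<in> cdom ?P p0" using p by simp
    have "subspace ?V" by (auto simp: subspace_def)
    moreover have "cmap ?P p0 ` (cdom ?P p0 \<inter> ?S) = {x \<in> ?U. x - cmap ?P p0 p \<in> ?V}"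
      using p inj[of _ "fst p0"] mem_cdom[OF mF, of "fst p0"]
      by (intro image_slice_eq) (auto simp: cmap_prod_atlas cdom_prod_atlas)
    moreover have "{v. fst v = 0} = {v. dfun ?P (cmap ?P p0) p v \<in> ?V}"
      using p by (simp add: dfun_cmap_prod_atlas dfun_cmap_self[OF mF])
    ultimately show "\<exists>U \<psi> V. compatible_chart ?P (U, \<psi>) \<and> p \<in> U \<and> subspace V \<and>
        \<psi> ` (U \<inter> ?S) = {x \<in> \<psi> ` U. x - \<psi> p \<in> V} \<and> {v. fst v = 0} = {v. dfun ?P \<psi> p v \<in> V}"
      using chart pU by (intro exI[of _ "cdom ?P p0"] exI[of _ "cmap ?P p0"] exI[of _ ?V] conjI)
  qed
  moreover have "p0 \<in> ?S" using mem_cdom[OF mP] by simp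
  ultimately show "\<exists>S. p0 \<in> S \<and> integral_manifold ?P (\<lambda>_. {v. fst v = 0}) S" by (intro exI[of _ ?S] conjI)
qed

text \<open>
  A local primitive \<open>h\<close> of the pulled back form becomes a coordinate function after
  the straightening diffeomorphism, so the leaves are the level sets of \<open>h\<close> in the slices
  \<open>snd = const\<close>.
\<close>

lemma integrable_kernel_in_first_factor:
  fixes ch :: "('a::{t2_space,second_countable_topology}, 'e::euclidean_space) atlas"
    and \<eta> :: "'a \<Rightarrow> 'e \<Rightarrow> real"
  assumes N: "smooth_manifold ch" and F: "smooth_map (prod_atlas chF chB) ch F"
    and lc: "levi_civita ch g nab" and par: "parallel_form ch nab \<eta>"
    and lin: "\<And>p. linear (\<eta> p)"
    and sm: "\<forall>W X. open W \<and> smooth_vf_on ch W X \<longrightarrow> smooth_fun_on ch W (\<lambda>q. \<eta> q (X q))"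
    and nz: "\<And>p. \<exists>u. \<eta> (F p) (differential (prod_atlas chF chB) ch F p (u, 0)) \<noteq> 0"
  shows "integrable_distribution (prod_atlas chF chB)
    (\<lambda>p. {v. snd v = 0 \<and> \<eta> (F p) (differential (prod_atlas chF chB) ch F p v) = 0})"
  unfolding integrable_distribution_def
proof
  fix p0
  let ?P = "prod_atlas chF chB"
  let ?D = "\<lambda>p. {v. snd v = 0 \<and> \<eta> (F p) (differential ?P ch F p v) = 0}"
  obtain U h where U: "open U" "cmap ?P p0 p0 \<in> U" "U \<subseteq> cmap ?P p0 ` cdom ?P p0" "smooth_on U h"
    and dh: "\<forall>p'\<in>cdom ?P p0. \<forall>v. cmap ?P p0 p' \<in> U \<longrightarrow>
      frechet_derivative h (at (cmap ?P p0 p')) (dfun ?P (cmap ?P p0) p' v)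
        = \<eta> (F p') (differential ?P ch F p' v)"
    by (rule parallel_form_pullback_primitive[OF mP N F lc par lin sm, of p0]) (rule that, assumption+)
  let ?z0 = "cmap ?P p0 p0"
  define \<Lambda> where "\<Lambda> = frechet_derivative h (at ?z0)"
  have h\<Lambda>: "(h has_derivative \<Lambda>) (at ?z0)"
    unfolding \<Lambda>_def using smooth_on_has_derivative[OF U(4,2)] .
  have \<Lambda>l: "linear \<Lambda>" using h\<Lambda> by (rule has_derivative_linear)
  obtain u where u: "\<Lambda> (u, 0) \<noteq> 0"
    using nz[of p0] dh[rule_format, of p0] mem_cdom[OF mP] U(2) by (auto simp: \<Lambda>_def dfun_cmap_self[OF mP])
  \<comment> \<open>Scaled so that \<open>\<Lambda> N = 1\<close>, and taken in the first factor so
    that \<open>G\<close> does not disturb the second coordinate.\<close>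
  define N where "N = inverse (\<Lambda> (u, 0)) *\<^sub>R (u, 0 :: 'h)"
  have N1: "\<Lambda> N = 1" unfolding N_def linear_scale[OF \<Lambda>l] using u by simp
  have sN: "snd N = 0" by (simp add: N_def)
  define G where "G = (\<lambda>z. z + (h z - \<Lambda> z) *\<^sub>R N)"
  obtain U' V J where U': "open U'" "?z0 \<in> U'" "U' \<subseteq> U" and V: "open V"
    and hom: "homeomorphism U' V G J" and G: "smooth_on U' G" and J: "smooth_on V J"
    by (rule straightening_diffeomorphism[OF U(1,4,2), of N, folded \<Lambda>_def, folded G_def, OF N1])
  let ?W = "cdom ?P p0 \<inter> cmap ?P p0 -` U'"
  let ?\<psi> = "G \<circ> cmap ?P p0"
  have chart: "compatible_chart ?P (?W, ?\<psi>)"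
    using U' U(3) by (intro compatible_chart_compose[OF mP _ _ V hom G J]) auto
  have \<Lambda>G: "\<Lambda> (G z) = h z" for z
    by (simp add: G_def linear_add[OF \<Lambda>l] linear_scale[OF \<Lambda>l] N1)
  have sG: "snd (G z) = snd z" for z by (simp add: G_def sN)
  \<comment> \<open>Because \<open>\<Lambda> \<circ> G = h\<close> and
    \<open>snd \<circ> G = snd\<close>, the map \<open>?\<psi>\<close> carries this level set to a
    slice parallel to \<open>?V\<close>.\<close>
  let ?S = "{q \<in> ?W. snd q = snd p0 \<and> h (cmap ?P p0 q) = h ?z0}"
  let ?V = "{v. \<Lambda> v = 0 \<and> snd v = 0}"
  have inj: "a = b" if "cmap chB (snd p0) a = cmap chB (snd p0) b" "a \<in> cdom chB (snd p0)"
    "b \<in> cdom chB (snd p0)" for a b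
    using that by (metis cinv_cmap[OF mB])
  have "integral_manifold ?P ?D ?S"
    unfolding integral_manifold_def
  proof
    fix p assume p: "p \<in> ?S"
    have pU: "p \<in> ?W" using p by simp
    have "subspace ?V"
      by (auto simp: subspace_def linear_0[OF \<Lambda>l] linear_add[OF \<Lambda>l] linear_scale[OF \<Lambda>l])
    moreover have "?\<psi> ` (?W \<inter> ?S) = {x \<in> ?\<psi> ` ?W. x - ?\<psi> p \<in> ?V}"
      using p inj[of _ "snd p0"] mem_cdom[OF mB, of "snd p0"]
      by (intro image_slice_eq) (auto simp: linear_diff[OF \<Lambda>l] \<Lambda>G sG cmap_prod_atlas cdom_prod_atlas)
    moreover have "?D p = {v. dfun ?P ?\<psi> p v \<in> ?V}"
    proof -
      let ?z = "cmap ?P p0 p"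
      let ?w = "dfun ?P (cmap ?P p0) p"
      have pc: "p \<in> cdom ?P p0" "?z \<in> U" using p U'(3) by auto
      have "(h has_derivative frechet_derivative h (at ?z)) (at ?z)"
        by (rule smooth_on_has_derivative[OF U(4) pc(2)])
      moreover have "(\<Lambda> has_derivative \<Lambda>) (at ?z)"
        by (rule bounded_linear_imp_has_derivative[OF has_derivative_bounded_linear[OF h\<Lambda>]])
      ultimately have "(G has_derivative (\<lambda>v. v + (frechet_derivative h (at ?z) v - \<Lambda> v) *\<^sub>R N)) (at ?z)"
        unfolding G_def
        by (intro has_derivative_add has_derivative_ident has_derivative_scaleR_left has_derivative_diff)
      then have "(G has_derivative (\<lambda>v. v + (frechet_derivative h (at ?z) v - \<Lambda> v) *\<^sub>R N))
          (at (cmap ?P p0 (cinv ?P p (cmap ?P p p))))"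
        by (simp add: cinv_cmap[OF mP] mem_cdom[OF mP])
      from has_derivative_compose[OF dfun_cmap_has_derivative[OF mP pc(1)] this]
      have dG: "((\<lambda>x. G (cmap ?P p0 (cinv ?P p x))) has_derivative
          (\<lambda>v. ?w v + (frechet_derivative h (at ?z) (?w v) - \<Lambda> (?w v)) *\<^sub>R N)) (at (cmap ?P p p))" .
      have "dfun ?P ?\<psi> p v = frechet_derivative (\<lambda>x. G (cmap ?P p0 (cinv ?P p x))) (at (cmap ?P p p)) v" for v
        by (simp only: dfun_def o_def)
      then have "dfun ?P ?\<psi> p v = ?w v + (frechet_derivative h (at ?z) (?w v) - \<Lambda> (?w v)) *\<^sub>R N" for v
        by (simp only: frechet_derivative_at[OF dG, symmetric])
      \<comment> \<open>The terms with \<open>\<Lambda>\<close>, frozen at \<open>p0\<close>, cancel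
        since \<open>\<Lambda> N = 1\<close>; what remains is the derivative of \<open>h\<close> at
        \<open>p\<close>, that is, the pulled back form there.\<close>
      then have "\<Lambda> (dfun ?P ?\<psi> p v) = \<eta> (F p) (differential ?P ch F p v)"
        "snd (dfun ?P ?\<psi> p v) = snd (?w v)" for v
        by (simp_all add: linear_add[OF \<Lambda>l] linear_scale[OF \<Lambda>l] N1 sN dh[rule_format, OF pc])
      \<comment> \<open>On \<open>?S\<close> the second coordinate is that of \<open>p0\<close>, so
        the second block of the transition is trivial.\<close>
      moreover have "snd (?w v) = snd v" for v
        using p by (simp add: dfun_cmap_prod_atlas[OF pc(1)] dfun_cmap_self[OF mB])
      ultimately show ?thesis by auto
    qed
    ultimately show "\<exists>U \<psi> V. compatible_chart ?P (U, \<psi>) \<and> p \<in> U \<and> subspace V \<and>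
        \<psi> ` (U \<inter> ?S) = {x \<in> \<psi> ` U. x - \<psi> p \<in> V} \<and> ?D p = {v. dfun ?P \<psi> p v \<in> V}"
      using chart pU by (intro exI[of _ ?W] exI[of _ ?\<psi>] exI[of _ ?V] conjI)
  qed
  moreover have "p0 \<in> ?S" using mem_cdom[OF mP] U'(2) by simp
  ultimately show "\<exists>S. p0 \<in> S \<and> integral_manifold ?P ?D S" by (intro exI[of _ ?S] conjI)
qed

end

section \<open>The warped product\<close>

text \<open>Linear algebra in one tangent space: \<open>L\<close> stands for the differential of the
  immersion and \<open>c\<close> for the squared warping function. Two facts drive it: a tangent
  vector that is also normal vanishes, by nondegeneracy, and a tangent vector killed by both \<phi>
  and \<eta> vanishes.\<close>

lemma warped_decomposition_unique:
  fixes \<phi> :: "'e::real_vector \<Rightarrow> 'e" and \<eta> :: "'e \<Rightarrow> real" and g :: "'e \<Rightarrow> 'e \<Rightarrow> real"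
    and L :: "'f::real_vector \<times> 'h::real_vector \<Rightarrow> 'e"
  assumes \<phi>: "linear \<phi>" and \<eta>: "linear \<eta>"
    and \<phi>\<phi>: "\<And>v. \<phi> (\<phi> v) = v - \<eta> v *\<^sub>R \<xi>" and \<eta>\<xi>: "\<eta> \<xi> = 1"
    and g: "bilinear g" and compat: "\<And>u v. g u v = - g (\<phi> u) (\<phi> v) + \<eta> u * \<eta> v"
    and g1: "bilinear g1" and g2: "bilinear g2" and c: "c \<noteq> 0"
    and nondeg2: "\<And>w. (\<And>w'. g2 w' w = 0) \<Longrightarrow> w = 0"
    and L: "linear L" "inj L"
    and gL: "\<And>u w u' w'. g (L (u, w)) (L (u', w')) = g1 u u' + c * g2 w w'"
    and nondeg: "\<And>v. (\<And>v'. g (L v) (L v') = 0) \<Longrightarrow> v = 0"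
    and D: "subspace D" and z: "L z = \<xi>" and z1: "L (z1, 0) = \<xi>"
    and orth: "\<And>a b. a \<in> D \<Longrightarrow> b \<in> Dp \<Longrightarrow> g (L a) (L b) = 0"
      "\<And>a. a \<in> D \<Longrightarrow> g (L a) (L z) = 0" "\<And>b. b \<in> Dp \<Longrightarrow> g (L b) (L z) = 0"
    and decomp: "\<And>v. \<exists>a b t. a \<in> D \<and> b \<in> Dp \<and> v = a + b + t *\<^sub>R z"
    and invD: "\<And>a. a \<in> D \<Longrightarrow> \<exists>a'\<in>D. \<phi> (L a) = L a'"
    and antiDp: "\<And>b v. b \<in> Dp \<Longrightarrow> g (\<phi> (L b)) (L v) = 0"
    and inv2: "\<And>w. \<exists>w'. \<phi> (L (0, w)) = L (0, w')"
    and anti1: "\<And>u u'. g (\<phi> (L (u, 0))) (L (u', 0)) = 0"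
  shows "D = {v. fst v = 0}" "Dp = {v. snd v = 0 \<and> \<eta> (L v) = 0}"
proof -
  note simps = linear_add[OF L(1)] linear_scale[OF L(1)] linear_add[OF \<eta>] linear_scale[OF \<eta>]
    linear_add[OF \<phi>] linear_scale[OF \<phi>] linear_0[OF \<phi>] linear_0[OF \<eta>] linear_0[OF L(1)]
    linear_diff[OF L(1)]
    bilinear_ladd[OF g] bilinear_radd[OF g] bilinear_lzero[OF g] bilinear_rzero[OF g]
    bilinear_lzero[OF g1] bilinear_rzero[OF g1] bilinear_lzero[OF g2] bilinear_rzero[OF g2]
  have z_eq: "z = (z1, 0)" using z z1 L(2) by (metis injD)
  \<comment> \<open>\<open>\<phi> (\<phi> \<xi>) = 0\<close> makes \<open>\<phi> \<xi>\<close> a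
    multiple of \<xi>; applying \<phi> once more shows that the coefficient or
    \<open>\<phi> \<xi>\<close> itself is zero.\<close>
  have \<phi>\<xi>: "\<phi> \<xi> = 0"
  proof -
    have "\<phi> (\<phi> (\<phi> \<xi>)) = 0" by (simp add: \<phi>\<phi>[of \<xi>] \<eta>\<xi> simps)
    then have e: "\<phi> \<xi> = \<eta> (\<phi> \<xi>) *\<^sub>R \<xi>" by (simp add: \<phi>\<phi>[of "\<phi> \<xi>"])
    have "0 = \<phi> (\<phi> \<xi>)" by (simp add: \<phi>\<phi>[of \<xi>] \<eta>\<xi>)
    also have "\<dots> = \<eta> (\<phi> \<xi>) *\<^sub>R \<phi> \<xi>" by (subst e) (simp add: simps)
    finally show ?thesis using e by (metis scale_eq_0_iff scale_zero_left)
  qed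
  have \<xi>0: "\<xi> \<noteq> 0" using \<eta>\<xi> linear_0[OF \<eta>] by auto
  \<comment> \<open>The cube of \<phi> is computed in two ways.\<close>
  have \<eta>\<phi>: "\<eta> (\<phi> v) = 0" for v
  proof -
    have "\<phi> v - \<eta> (\<phi> v) *\<^sub>R \<xi> = \<phi> (v - \<eta> v *\<^sub>R \<xi>)" by (metis \<phi>\<phi>)
    also have "\<dots> = \<phi> v" by (simp add: linear_diff[OF \<phi>] simps \<phi>\<xi>)
    finally show ?thesis using \<xi>0 by simp
  qed
  have g\<xi>: "g v \<xi> = \<eta> v" for v using compat[of v \<xi>] by (simp add: \<phi>\<xi> simps \<eta>\<xi>)
  have skew: "g v (\<phi> w) = - g (\<phi> v) w" for v w
    using compat[of v "\<phi> w"] by (simp add: \<phi>\<phi> \<eta>\<phi> bilinear_rsub[OF g] bilinear_rmul[OF g] g\<xi>)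
  have \<eta>L: "\<eta> (L v) = g (L v) (L z)" for v using g\<xi> z by simp
  have inj0: "v = 0" if "L v = 0" for v using that L by (metis injD linear_0)
  have orth12: "g (L (u, 0)) (L (0, w)) = 0" "g (L (0, w)) (L (u, 0)) = 0" for u w
    by (simp_all add: gL simps)
  have ker: "v = 0" if "\<phi> (L v) = 0" "\<eta> (L v) = 0" for v
    using \<phi>\<phi>[of "L v"] that by (intro inj0) (simp add: simps)
  have split: "(u, w) = (u, 0) + (0, w)" for u :: 'f and w :: 'h by simp
  have D2: "(0, w) \<in> D" for w
  proof -
    obtain a b t where abt: "a \<in> D" "b \<in> Dp" "(0, w) = a + b + t *\<^sub>R z" using decomp by blast
    obtain a' where a': "\<phi> (L a) = L a'" using invD abt(1) by blast
    obtain w' where w': "\<phi> (L (0, w)) = L (0, w')" using inv2 by blast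
    have "L (0, w') = L a' + \<phi> (L b)"
      unfolding w'[symmetric] abt(3) by (simp add: simps a' z \<phi>\<xi>)
    then have b: "\<phi> (L b) = L ((0, w') - a')" by (simp add: simps)
    \<comment> \<open>\<open>\<phi> (L b)\<close> is normal by anti-invariance, and tangent because
      \<phi> keeps the other summands of the decomposition tangent.\<close>
    then have "(0, w') - a' = 0" using antiDp[OF abt(2)] by (intro nondeg) simp
    then have "b = 0" using b orth(3)[OF abt(2)] by (intro ker) (auto simp: simps \<eta>L)
    moreover have "\<eta> (L (0, w)) = 0" by (simp add: \<eta>L z_eq orth12)
    then have "t = 0" using orth(2)[OF abt(1)] \<open>b = 0\<close> unfolding abt(3) by (simp add: simps z \<eta>\<xi> \<eta>L)
    ultimately show ?thesis using abt by simp
  qed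
  have D1: "u = 0" if "(u, w) \<in> D" for u w
  proof -
    have "(u, w) - (0, w) \<in> D" using D that D2 by (rule subspace_diff)
    then have u: "(u, 0) \<in> D" by simp
    then obtain d where d: "d \<in> D" "\<phi> (L (u, 0)) = L d" using invD by blast
    \<comment> \<open>\<open>L d\<close> is orthogonal to the first factor by anti-invariance. For
      the second, skewness moves \<phi> to the other argument, where invariance keeps it in the
      second factor.\<close>
    have "g (L d) (L (u', w')) = 0" for u' w'
    proof -
      obtain w'' where "\<phi> (L (0, w')) = L (0, w'')" using inv2 by blast
      then have "g (L d) (L (0, w')) = 0"
        using skew[of "L (u, 0)" "L (0, w')"] d(2) orth12(1)[of u w''] by simp
      then show ?thesis
        using anti1[of u u'] d(2) by (subst split) (simp only: simps)
    qed
    then have "d = 0" by (intro nondeg) (metis surj_pair)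
    then have "(u, 0) = (0 :: 'f \<times> 'h)"
      using d(2) orth(2)[OF u] by (intro ker) (simp_all add: simps \<eta>L)
    then show "u = 0" by (simp add: zero_prod_def)
  qed
  show D_eq: "D = {v. fst v = 0}" using D1 D2 by auto
  \<comment> \<open>\<open>D\<close> is now the whole second factor, so orthogonality to it and
    nondegeneracy of \<open>g2\<close> remove the second component.\<close>
  have Dp: "snd b = 0 \<and> \<eta> (L b) = 0" if b: "b \<in> Dp" for b
  proof -
    have "g2 w' (snd b) = 0" for w'
      using orth(1)[OF D2 b, of w'] gL[of 0 w' "fst b" "snd b"] c by (simp add: simps)
    then have "snd b = 0" by (rule nondeg2)
    then show ?thesis using orth(3)[OF b] by (simp add: \<eta>L)
  qed
  have "v \<in> Dp" if v: "snd v = 0" "\<eta> (L v) = 0" for v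
  proof -
    obtain a b t where abt: "a \<in> D" "b \<in> Dp" "v = a + b + t *\<^sub>R z" using decomp by blast
    have "\<eta> (L a) = 0" using orth(2)[OF abt(1)] by (simp add: \<eta>L)
    then have t: "t = 0" using v(2) Dp[OF abt(2)] unfolding abt(3) by (simp add: simps z \<eta>\<xi>)
    then have "a = 0" using v(1) Dp[OF abt(2)] abt(1) unfolding abt(3) D_eq
      by (auto simp: prod_eq_iff)
    then show ?thesis using abt t by simp
  qed
  then show "Dp = {v. snd v = 0 \<and> \<eta> (L v) = 0}" using Dp by auto
qed

theorem theorem4p5:
  fixes m :: nat
    and ch :: "('a::{t2_space,second_countable_topology}, 'e::euclidean_space) atlas"
    and \<phi> :: "'a \<Rightarrow> 'e \<Rightarrow> 'e" and \<xi> :: "'a \<Rightarrow> 'e" and \<eta> :: "'a \<Rightarrow> 'e \<Rightarrow> real"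
    and g :: "'a \<Rightarrow> 'e \<Rightarrow> 'e \<Rightarrow> real"
    and chF :: "('b::{t2_space,second_countable_topology}, 'f::euclidean_space) atlas"
    and gF :: "'b \<Rightarrow> 'f \<Rightarrow> 'f \<Rightarrow> real"
    and chB :: "('c::{t2_space,second_countable_topology}, 'h::euclidean_space) atlas"
    and gB :: "'c \<Rightarrow> 'h \<Rightarrow> 'h \<Rightarrow> real"
    and f :: "'b \<Rightarrow> real" and \<iota> :: "'b \<times> 'c \<Rightarrow> 'a"
    and D Dp :: "'b \<times> 'c \<Rightarrow> ('f \<times> 'h) set"
  assumes "paracosymplectic m ch \<phi> \<xi> \<eta> g"
    and "PR_semi_invariant_warped_product ch \<phi> \<xi> g chF gF chB gB f \<iota> D Dp"
    and "tangent_to_first_factor ch \<xi> chF \<iota>"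
  shows "integrable_distribution (prod_atlas chF chB) D \<and>
    integrable_distribution (prod_atlas chF chB) Dp"
proof -
  let ?P = "prod_atlas chF chB"
  let ?L = "\<lambda>p. differential ?P ch \<iota> p"
  obtain nab where lc: "levi_civita ch g nab" and par: "parallel_form ch nab \<eta>"
    using assms(1) unfolding paracosymplectic_def by (elim exE conjE) (rule that)
  have apm: "almost_paracontact_metric m ch \<phi> \<xi> \<eta> g"
    using assms(1) unfolding paracosymplectic_def by (rule conjunct1)
  then have ap: "almost_paracontact m ch \<phi> \<xi> \<eta>" and psg: "pseudo_riemannian ch g"
    and compat: "\<forall>p u v. g p u v = - g p (\<phi> p u) (\<phi> p v) + \<eta> p u * \<eta> p v"
    unfolding almost_paracontact_metric_def by - (elim conjE, assumption)+
  have \<phi>: "\<forall>p. linear (\<phi> p)" and \<eta>: "\<forall>p. linear (\<eta> p)"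
    and \<phi>\<phi>: "\<forall>p v. \<phi> p (\<phi> p v) = v - \<eta> p v *\<^sub>R \<xi> p" and \<eta>\<xi>: "\<forall>p. \<eta> p (\<xi> p) = 1"
    and sm: "\<forall>W X. open W \<and> smooth_vf_on ch W X \<longrightarrow> smooth_fun_on ch W (\<lambda>q. \<eta> q (X q))"
    using ap unfolding almost_paracontact_def by - (elim conjE, assumption)+
  have N: "smooth_manifold ch" and g: "\<forall>p. bilinear (g p)"
    using psg unfolding pseudo_riemannian_def by - (elim conjE, assumption)+
  have psF: "pseudo_riemannian chF gF" and psB: "pseudo_riemannian chB gB"
    and fpos: "\<forall>x. f x > 0"
    and PR: "PR_semi_invariant ch \<phi> \<xi> g ?P (warped_metric f gF gB) \<iota> D Dp"
    and invB: "\<forall>x. invariant_submanifold chB ch \<phi> (\<lambda>y. \<iota> (x, y))"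
    and antiF: "\<forall>y. anti_invariant_submanifold chF ch \<phi> g (\<lambda>x. \<iota> (x, y))"
    using assms(2) unfolding PR_semi_invariant_warped_product_def by - (elim conjE, assumption)+
  have mF: "smooth_manifold chF" and mB: "smooth_manifold chB"
    and gF: "\<forall>p. bilinear (gF p)" and gB: "\<forall>p. bilinear (gB p)"
    and gB_sym: "\<forall>p u v. gB p u v = gB p v u"
    and gB_nondeg: "\<forall>p u. (\<forall>v. gB p u v = 0) \<longrightarrow> u = 0"
    using psF psB unfolding pseudo_riemannian_def by - (elim conjE, assumption)+
  have psM: "pseudo_riemannian ?P (warped_metric f gF gB)"
    and iso: "isometric_immersion ?P (warped_metric f gF gB) ch g \<iota>"
    and distD: "distribution ?P D"
    and frame: "\<forall>p. \<exists>z. ?L p z = \<xi> (\<iota> p) \<and>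
        (\<forall>a\<in>D p. \<forall>b\<in>Dp p. warped_metric f gF gB p a b = 0) \<and>
        (\<forall>a\<in>D p. warped_metric f gF gB p a z = 0) \<and> (\<forall>b\<in>Dp p. warped_metric f gF gB p b z = 0) \<and>
        (\<forall>v. \<exists>!(a, b, t). a \<in> D p \<and> b \<in> Dp p \<and> v = a + b + t *\<^sub>R z)"
    and invD: "\<forall>p. \<phi> (\<iota> p) ` (?L p ` D p) = ?L p ` D p"
    and antiDp: "\<forall>p. \<forall>b\<in>Dp p. \<forall>v. g (\<iota> p) (\<phi> (\<iota> p) (?L p b)) (?L p v) = 0"
    using PR unfolding PR_semi_invariant_def by - (elim conjE, assumption)+
  have mP: "smooth_manifold ?P"
    and nondeg: "\<forall>p u. (\<forall>v. warped_metric f gF gB p u v = 0) \<longrightarrow> u = 0"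
    using psM unfolding pseudo_riemannian_def by - (elim conjE, assumption)+
  have F: "smooth_map ?P ch \<iota>" and L_inj: "\<forall>p. inj (?L p)"
    and gL: "\<forall>p u v. warped_metric f gF gB p u v = g (\<iota> p) (?L p u) (?L p v)"
    using iso unfolding isometric_immersion_def immersion_def by - (elim conjE, assumption)+
  have L: "linear (?L p)" for p
    by (rule has_derivative_linear[OF differential_has_derivative[OF mP N F]])
  have subD: "subspace (D p)" for p using distD unfolding distribution_def
    by (rule exE) (drule spec[of _ p], erule conjunct1)
  have \<xi>1: "\<exists>u. ?L p (u, 0) = \<xi> (\<iota> p)" for p
  proof -
    have "\<xi> (\<iota> (fst p, snd p)) \<in> range (differential chF ch (\<lambda>x. \<iota> (x, snd p)) (fst p))"
      by (rule assms(3)[unfolded tangent_to_first_factor_def, THEN spec, THEN spec])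
    then obtain u where "\<xi> (\<iota> (fst p, snd p)) = differential chF ch (\<lambda>x. \<iota> (x, snd p)) (fst p) u"
      by (rule rangeE)
    then show ?thesis
      by (intro exI[of _ u]) (simp add: differential_slice1[OF mF mB mP N F])
  qed
  \<comment> \<open>Pointwise instance with the differential of \<iota> at \<open>p\<close> and
    \<open>c = (f x)\<^sup>2\<close>, nonzero because the warping function is positive.\<close>
  have eq: "D p = {v. fst v = 0} \<and> Dp p = {v. snd v = 0 \<and> \<eta> (\<iota> p) (?L p v) = 0}" for p
  proof -
    obtain x y where p: "p = (x, y)" by (cases p)
    obtain z where z: "?L p z = \<xi> (\<iota> p)"
      "\<forall>a\<in>D p. \<forall>b\<in>Dp p. warped_metric f gF gB p a b = 0"
      "\<forall>a\<in>D p. warped_metric f gF gB p a z = 0" "\<forall>b\<in>Dp p. warped_metric f gF gB p b z = 0"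
      "\<forall>v. \<exists>!(a, b, t). a \<in> D p \<and> b \<in> Dp p \<and> v = a + b + t *\<^sub>R z"
      using spec[OF frame, of p] by (elim exE conjE) (rule that)
    obtain z1 where z1: "?L p (z1, 0) = \<xi> (\<iota> p)" using \<xi>1 by blast
    have wm: "g (\<iota> p) (?L p (u, w)) (?L p (u', w')) = gF x u u' + (f x)\<^sup>2 * gB y w w'" for u w u' w'
      by (simp add: p warped_metric_def flip: gL[rule_format])
    have c: "(f x)\<^sup>2 \<noteq> 0" using fpos[rule_format, of x] by simp
    have nd2: "w = 0" if "\<And>w'. gB y w' w = 0" for w
      using spec[OF spec[OF gB_nondeg, of y], of w] that gB_sym[rule_format, of y w] by simp
    have nd: "v = 0" if "\<And>v'. g (\<iota> p) (?L p v) (?L p v') = 0" for v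
      using spec[OF spec[OF nondeg, of p], of v] that by (simp add: gL[rule_format])
    have dec: "\<exists>a b t. a \<in> D p \<and> b \<in> Dp p \<and> v = a + b + t *\<^sub>R z" for v
      using ex1_implies_ex[OF z(5)[rule_format, of v]] by auto
    have iD: "\<exists>a'\<in>D p. \<phi> (\<iota> p) (?L p a) = ?L p a'" if "a \<in> D p" for a
      using spec[OF invD, of p] that by blast
    have i2: "\<exists>w'. \<phi> (\<iota> p) (?L p (0, w)) = ?L p (0, w')" for w
      using spec[OF invB, of x] unfolding invariant_submanifold_def p differential_slice2[OF mF mB mP N F] by blast
    have a1: "g (\<iota> p) (\<phi> (\<iota> p) (?L p (u, 0))) (?L p (u', 0)) = 0" for u u'
      using spec[OF antiF, of y] unfolding anti_invariant_submanifold_def p differential_slice1[OF mF mB mP N F] by blast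
    have o: "g (\<iota> p) (?L p a) (?L p b) = 0" if "a \<in> D p" "b \<in> Dp p" for a b
      using z(2) that by (simp add: gL[rule_format])
    have oz: "g (\<iota> p) (?L p a) (?L p z) = 0" if "a \<in> D p" for a
      using z(3) that by (simp add: gL[rule_format])
    have oz': "g (\<iota> p) (?L p b) (?L p z) = 0" if "b \<in> Dp p" for b
      using z(4) that by (simp add: gL[rule_format])
    note W = warped_decomposition_unique[of "\<phi> (\<iota> p)" "\<eta> (\<iota> p)" "\<xi> (\<iota> p)" "g (\<iota> p)" "gF x" "gB y"
        "(f x)\<^sup>2" "?L p" "D p" z z1 "Dp p", OF spec[OF \<phi>] spec[OF \<eta>]
        \<phi>\<phi>[rule_format] spec[OF \<eta>\<xi>] spec[OF g] compat[rule_format] spec[OF gF] spec[OF gB] c nd2 L spec[OF L_inj]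
        wm nd subD z(1) z1 o oz oz' dec iD antiDp[rule_format] i2 a1]
    show ?thesis using W by blast
  qed
  \<comment> \<open>The witness is the first-factor vector representing \<xi>, on which \<eta>
    equals 1; it makes the level sets of the primitive regular within the slices.\<close>
  have nz: "\<exists>u. \<eta> (\<iota> p) (?L p (u, 0)) \<noteq> 0" for p
    using \<xi>1[of p] spec[OF \<eta>\<xi>, of "\<iota> p"] by (metis zero_neq_one)
  have "D = (\<lambda>_. {v. fst v = 0})" "Dp = (\<lambda>p. {v. snd v = 0 \<and> \<eta> (\<iota> p) (?L p v) = 0})"
    using eq by auto
  then show ?thesis
    using integrable_second_factor[OF mF mB mP]
      integrable_kernel_in_first_factor[OF mF mB mP N F lc par spec[OF \<eta>] sm nz] by simp
qed

end
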